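(* There is no $PG(3,2)$-free matroid $M$ with $|M|>(1-3\cdot 2^{-4})2^{r(M)}$ and $\chi(M)>4$.
   Context: A matroid $M$ means a simple binary matroid, represented by an integer $r(M)\geq 0$ (its rank) and a set $E(M)\subseteq \mathbb{F}_2^{r(M)}\setminus\{0\}$ that spans $\mathbb{F}_2^{r(M)}$; $|M|:=|E(M)|$. The critical number $\chi(M)$ is the smallest $k$ such that some subspace of $\mathbb{F}_2^{r(M)}$ of codimension $k$ is disjoint from $E(M)$. A matroid $M$ contains a matroid $N$ if there is an injective linear map $\iota:\mathbb{F}_2^{r(N)}\to\mathbb{F}_2^{r(M)}$ with $\iota(E(N))\subseteq E(M)$; $M$ is $N$-free if it does not contain $N$. The projective geometry $PG(s-1,2)$ is the matroid of rank $s$ with edge set $\mathbb{F}_2^s\setminus\{0\}$. *)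

theory Defs
  imports
    "HOL-Library.Z2"
    "Jordan_Normal_Form.VS_Connect"
begin

text \<open>
  The space \<open>\<bbbF>\<^sub>2\<^sup>r\<close> is \<^term>\<open>module_vec TYPE(bit) r\<close> over the field
  \<^term>\<open>class_ring :: bit ring\<close>, with carrier \<^term>\<open>carrier_vec r :: bit vec set\<close>.
  The case \<open>r = 0\<close> is included.
\<close>

abbreviation F2 :: "bit ring"
  where "F2 \<equiv> class_ring"

abbreviation F2_space :: "nat \<Rightarrow> (bit, bit vec) module"
  where "F2_space r \<equiv> module_vec TYPE(bit) r"

record binary_matroid =
  mrank :: nat
  edges :: "bit vec set"

definition simple_binary_matroid :: "binary_matroid \<Rightarrow> bool" where
  "simple_binary_matroid M \<longleftrightarrow>
     edges M \<subseteq> carrier_vec (mrank M) - {0\<^sub>v (mrank M)} \<and>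
     LinearCombinations.module.span F2 (F2_space (mrank M)) (edges M) = carrier_vec (mrank M)"

definition F2_subspace_codim :: "nat \<Rightarrow> bit vec set \<Rightarrow> nat \<Rightarrow> bool" where
  "F2_subspace_codim r W k \<longleftrightarrow>
     VectorSpace.subspace F2 W (F2_space r) \<and>
     vectorspace.dim F2 ((F2_space r)\<lparr>carrier := W\<rparr>) + k = r"

text \<open>For a simple binary matroid the minimum exists: the zero subspace, of codimension
  \<^term>\<open>mrank M\<close>, is disjoint from \<^term>\<open>edges M\<close>.\<close>

definition critical_number :: "binary_matroid \<Rightarrow> nat" where
  "critical_number M =
     (LEAST k. \<exists>W. F2_subspace_codim (mrank M) W k \<and> W \<inter> edges M = {})"

definition contains_matroid :: "binary_matroid \<Rightarrow> binary_matroid \<Rightarrow> bool" where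
  "contains_matroid M N \<longleftrightarrow>
     (\<exists>\<iota>. linear_map F2 (F2_space (mrank N)) (F2_space (mrank M)) \<iota> \<and>
          inj_on \<iota> (carrier_vec (mrank N)) \<and>
          \<iota> ` edges N \<subseteq> edges M)"

definition matroid_free :: "binary_matroid \<Rightarrow> binary_matroid \<Rightarrow> bool" where
  "matroid_free N M \<longleftrightarrow> \<not> contains_matroid M N"

text \<open>The argument is the rank, not the projective dimension: \<open>PG(s - 1, 2)\<close> is
  \<open>proj_geom s\<close>.\<close>

definition proj_geom :: "nat \<Rightarrow> binary_matroid" where
  "proj_geom s = \<lparr>mrank = s, edges = carrier_vec s - {0\<^sub>v s}\<rparr>"

end

theory Submission
  imports Defs "HOL-Library.Function_Algebras" "HOL-Analysis.Convex" "Jordan_Normal_Form.DL_Rank"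
begin

text \<open>
  Let \<open>E\<close> be the edge set in \<open>G = \<bbbF>\<^sub>2\<^sup>r\<close> and \<open>B = G - E\<close>, so that \<open>card B < 3/16 card G\<close>.
  If some hyperplane section of \<open>E\<close> contains no \<open>PG(2,2)\<close>, and some hyperplane section of that
  contains no triangle, then what remains is a triangle-free set of density above \<open>1/4\<close>, and it
  suffices to show that such a set misses a subspace of codimension two.

  A geometry of rank \<open>t - 1\<close> in a \<open>PG(t-1,2)\<close>-free set \<open>E\<close> has a point of \<open>B\<close> in each of its
  cosets. Hence, if every hyperplane \<open>H\<close> contained one, then \<open>B\<close> would be large both on \<open>H\<close> and
  off \<open>H\<close>, for all \<open>H\<close>. For \<open>t = 4\<close> this contradicts the case \<open>t = 3\<close> applied to
  \<open>E \<inter> (E + v)\<close> modulo a point \<open>v\<close> of \<open>E\<close>. For \<open>t = 3\<close> it bounds the Fourier coefficients of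
  \<open>E\<close> from below, hence gives many triangles, while each \<open>E \<inter> (E + v)\<close> is triangle-free and
  has density at most \<open>5/16\<close> unless it misses a hyperplane.

  The \<open>5/16\<close>, and the case of triangle-free sets, come from shortest odd relations
  \<open>c\<^sub>1 + \<dots> + c\<^sub>k = 0\<close> in \<open>E\<close>: each translate of the span of the \<open>c\<^sub>i\<close> has \<open>2^(k-1)\<close> points, of
  which at most \<open>k\<close> are in \<open>E\<close>. If a triangle-free set met every subspace of codimension two, each
  hyperplane would contain an odd relation, which again bounds all Fourier coefficients from below
  and forces a triangle.
\<close>

section \<open>Finite elementary abelian 2-groups\<close>

class elem_2_group = ab_group_add +
  assumes add_self [simp]: "x + x = 0"
begin

lemma add_self_left [simp]: "x + (x + y) = y"
  using add.assoc[of x x y] by simp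

lemma add_eq_0_iff_eq [simp]: "x + y = 0 \<longleftrightarrow> x = y"
  by (metis add_self add_left_cancel)

lemma add_eq_iff_add: "x + y = z \<longleftrightarrow> x = y + z"
  by (metis add_self_left add.commute)

end

text \<open>Spaces are subgroups inside one ambient type, so that hyperplanes of hyperplanes stay in
  that type. Closure under inverses is automatic, since every element is its own inverse.\<close>

definition fin_subgroup :: "'a::elem_2_group set \<Rightarrow> bool" where
  "fin_subgroup G \<longleftrightarrow> finite G \<and> 0 \<in> G \<and> (\<forall>x\<in>G. \<forall>y\<in>G. x + y \<in> G)"

lemma fin_subgroupD:
  assumes "fin_subgroup G"
  shows "finite G" "0 \<in> G" "x \<in> G \<Longrightarrow> y \<in> G \<Longrightarrow> x + y \<in> G"
  using assms by (auto simp: fin_subgroup_def)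

lemma fin_subgroup_add_iff:
  assumes "fin_subgroup G" "x \<in> G"
  shows "x + y \<in> G \<longleftrightarrow> y \<in> G" "y + x \<in> G \<longleftrightarrow> y \<in> G"
  using fin_subgroupD(3)[OF assms(1,2)] by (metis add_self_left add.commute)+

lemma fin_subgroup_card_pos: "fin_subgroup G \<Longrightarrow> card G > 0"
  by (auto simp: fin_subgroup_def card_gt_0_iff)

text \<open>These are the hyperplanes of \<open>G\<close> seen as a space over F_2.\<close>

definition index2 :: "'a::elem_2_group set \<Rightarrow> 'a set \<Rightarrow> bool" where
  "index2 H G \<longleftrightarrow> fin_subgroup H \<and> H \<subseteq> G \<and> 2 * card H = card G"

lemma card_translate [simp]: "card ((+) x ` S) = card S" for x :: "'a::elem_2_group"
  by (simp add: card_image)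

lemma fin_subgroup_adjoin:
  assumes K: "fin_subgroup K" and x: "x \<notin> K"
  shows "fin_subgroup (K \<union> (+) x ` K)" "card (K \<union> (+) x ` K) = 2 * card K"
    "index2 K (K \<union> (+) x ` K)"
proof -
  show 1: "fin_subgroup (K \<union> (+) x ` K)"
    unfolding fin_subgroup_def
  proof (intro conjI ballI)
    fix u v assume "u \<in> K \<union> (+) x ` K" "v \<in> K \<union> (+) x ` K"
    then consider "u \<in> K" "v \<in> K" | k where "u \<in> K" "v = x + k" "k \<in> K"
      | k where "u = x + k" "k \<in> K" "v \<in> K" | k l where "u = x + k" "v = x + l" "k \<in> K" "l \<in> K"
      by auto
    then show "u + v \<in> K \<union> (+) x ` K"
    proof cases
      case 2
      then have "u + v = x + (u + k)" by (simp add: ac_simps)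
      then show ?thesis using 2 fin_subgroupD(3)[OF K] by blast
    next
      case 3
      then have "u + v = x + (k + v)" by (simp add: ac_simps)
      then show ?thesis using 3 fin_subgroupD(3)[OF K] by blast
    next
      case 4
      then have "u + v = k + l"
        by (metis add.assoc add.commute add_self_left)
      then show ?thesis using fin_subgroupD(3)[OF K 4(3,4)] by simp
    qed (use fin_subgroupD(3)[OF K] in auto)
  qed (use fin_subgroupD[OF K] in auto)
  have "K \<inter> (+) x ` K = {}"
    using x fin_subgroup_add_iff[OF K] by auto
  then show 2: "card (K \<union> (+) x ` K) = 2 * card K"
    using fin_subgroupD(1)[OF K] by (subst card_Un_disjoint) auto
  show "index2 K (K \<union> (+) x ` K)" using 2 K by (auto simp: index2_def)
qed

lemma index2_Diff:
  assumes G: "fin_subgroup G" and H: "index2 H G" and x: "x \<in> G - H"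
  shows "G - H = (+) x ` H"
proof -
  have H': "fin_subgroup H" "H \<subseteq> G" "2 * card H = card G" using H by (auto simp: index2_def)
  have "(+) x ` H \<subseteq> G - H"
    using x H' fin_subgroupD(3)[OF G] fin_subgroup_add_iff[OF H'(1)] by auto
  moreover have "card ((+) x ` H) = card (G - H)"
    using H' fin_subgroupD(1)[OF G] by (subst card_Diff_subset) (auto simp: finite_subset)
  ultimately show ?thesis
    using fin_subgroupD(1)[OF G] card_subset_eq[of "G - H" "(+) x ` H"] by auto
qed

lemma index2_props:
  assumes G: "fin_subgroup G" and H: "index2 H G"
  shows "fin_subgroup H" "H \<subseteq> G" "card G = 2 * card H" "card (G - H) = card H"
    "\<exists>x. x \<in> G - H" "finite G" "finite H"
    "x \<in> G - H \<Longrightarrow> y \<in> G - H \<Longrightarrow> x + y \<in> H"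
    "x \<in> H \<Longrightarrow> y \<in> G - H \<Longrightarrow> x + y \<in> G - H"
proof -
  show H': "fin_subgroup H" "H \<subseteq> G" and c: "card G = 2 * card H" using H by (auto simp: index2_def)
  show fin: "finite G" "finite H" using G H' by (auto simp: fin_subgroup_def)
  show c2: "card (G - H) = card H" using H' fin c by (simp add: card_Diff_subset)
  have "card (G - H) > 0" using c2 fin_subgroup_card_pos[OF H'(1)] by simp
  then show "\<exists>x. x \<in> G - H" by (auto simp: card_gt_0_iff)
  show "x + y \<in> H" if xy: "x \<in> G - H" "y \<in> G - H"
  proof -
    obtain h where "h \<in> H" "y = x + h" using index2_Diff[OF G H xy(1)] xy(2) by auto
    then show ?thesis by simp
  qed
  show "x + y \<in> G - H" if "x \<in> H" "y \<in> G - H"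
    using that H' fin_subgroupD(3)[OF G, of x y] fin_subgroup_add_iff[OF H'(1) that(1)] by auto
qed

lemma index2_card_Un:
  assumes "fin_subgroup G" "index2 H G" "A \<subseteq> G"
  shows "card A = card (A \<inter> H) + card (A - H)"
  using assms(3) index2_props(6)[OF assms(1,2)] 
  by (metis Diff_Diff_Int Int_Diff_Un Int_Diff_disjoint card_Un_disjoint finite_Diff finite_Int finite_subset)

text \<open>A subgroup that is maximal among those avoiding \<open>x\<close> has index two.\<close>
lemma index2_separating:
  assumes G: "fin_subgroup G" and L: "fin_subgroup L" "L \<subseteq> G" and x: "x \<in> G" "x \<notin> L"
  obtains K where "index2 K G" "L \<subseteq> K" "x \<notin> K"
proof -
  define \<K> where "\<K> = {K. fin_subgroup K \<and> L \<subseteq> K \<and> K \<subseteq> G \<and> x \<notin> K}"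
  have "finite \<K>" using fin_subgroupD(1)[OF G] by (auto simp: \<K>_def intro: finite_subset[of _ "Pow G"])
  moreover have "L \<in> \<K>" using L x by (auto simp: \<K>_def)
  ultimately obtain K where K: "K \<in> \<K>" "L \<subseteq> K" and max: "\<And>K'. K' \<in> \<K> \<Longrightarrow> K \<subseteq> K' \<Longrightarrow> K = K'"
    by (metis finite_has_maximal2)
  have K': "fin_subgroup K" "K \<subseteq> G" "x \<notin> K" using K by (auto simp: \<K>_def)
  \<comment> \<open>By maximality, adjoining \<open>y\<close> to \<open>K\<close> must bring in
    \<open>x\<close>; so \<open>x\<close> lies in the coset of \<open>y\<close>, and the two cosets
    coincide.\<close>
  have "y \<in> (+) x ` K" if y: "y \<in> G" "y \<notin> K" for y
  proof -
    let ?K = "K \<union> (+) y ` K"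
    have "y \<in> ?K" using fin_subgroupD(2)[OF K'(1)] by force
    then have "?K \<notin> \<K>" using max[of ?K] y by blast
    moreover have "?K \<subseteq> G" using K' y fin_subgroupD(3)[OF G] by auto
    ultimately have "x \<in> ?K"
      using fin_subgroup_adjoin(1)[OF K'(1) y(2)] K by (auto simp: \<K>_def)
    then obtain k where "k \<in> K" "x = y + k" using K' by auto
    then have "y = x + k" by (metis add_eq_iff_add add.commute)
    then show ?thesis using \<open>k \<in> K\<close> by auto
  qed
  then have "G = K \<union> (+) x ` K"
    using K' x(1) fin_subgroupD(3)[OF G] by auto
  then have "index2 K G" using fin_subgroup_adjoin(3)[OF K'(1,3)] by simp
  then show thesis using that K K' by blast
qed

lemma index2_exists:
  assumes "fin_subgroup G" "x \<in> G" "x \<noteq> 0"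
  obtains K where "index2 K G" "x \<notin> K"
proof -
  have "fin_subgroup {0::'a}" by (auto simp: fin_subgroup_def)
  then show thesis using index2_separating[OF assms(1), of "{0}" x] assms fin_subgroupD(2)[OF assms(1)] that by auto
qed

text \<open>If \<open>y + s = b\<close>, then \<open>y = b + s\<close>; so the pairs from
  \<open>B \<inter> Y\<close> and \<open>S\<close> cover \<open>Y\<close>.\<close>

lemma card_le_card_times_meeting:
  assumes "finite Y" "finite S" and inv: "\<And>y s. y \<in> Y \<Longrightarrow> s \<in> S \<Longrightarrow> y + s \<in> Y"
    and meet: "\<And>y. y \<in> Y \<Longrightarrow> \<exists>s\<in>S. y + s \<in> B"
  shows "card Y \<le> card (B \<inter> Y) * card (S :: 'a::elem_2_group set)"
proof -
  have "Y \<subseteq> (\<lambda>(b, s). b + s) ` ((B \<inter> Y) \<times> S)"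
  proof
    fix y assume y: "y \<in> Y"
    then obtain s where s: "s \<in> S" "y + s \<in> B" using meet by blast
    then have "y = (y + s) + s" "y + s \<in> B \<inter> Y" using inv y by (auto simp: add.assoc)
    then show "y \<in> (\<lambda>(b, s). b + s) ` ((B \<inter> Y) \<times> S)" using s by force
  qed
  then have "card Y \<le> card ((B \<inter> Y) \<times> S)"
    using assms(1,2) by (intro surj_card_le) auto
  then show ?thesis by (simp add: card_cartesian_product)
qed

section \<open>Characters\<close>

text \<open>Signs suffice as values, since every element has order at most two. The value 1 outside
  \<open>G\<close> makes a character determined by its restriction to \<open>G\<close>, so there are
  finitely many.\<close>

definition characters :: "'a::elem_2_group set \<Rightarrow> ('a \<Rightarrow> real) set" where
  "characters G = {\<chi>. (\<forall>x\<in>G. \<chi> x = 1 \<or> \<chi> x = -1) \<and>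
     (\<forall>x\<in>G. \<forall>y\<in>G. \<chi> (x + y) = \<chi> x * \<chi> y) \<and> (\<forall>x. x \<notin> G \<longrightarrow> \<chi> x = 1)}"

lemma charactersD:
  assumes "\<chi> \<in> characters G"
  shows "x \<in> G \<Longrightarrow> \<chi> x = 1 \<or> \<chi> x = -1" "x \<in> G \<Longrightarrow> y \<in> G \<Longrightarrow> \<chi> (x + y) = \<chi> x * \<chi> y"
    "x \<notin> G \<Longrightarrow> \<chi> x = 1"
  using assms by (auto simp: characters_def)

lemma trivial_character [simp]: "(\<lambda>_. 1) \<in> characters G"
  by (simp add: characters_def)

lemma character_0: "fin_subgroup G \<Longrightarrow> \<chi> \<in> characters G \<Longrightarrow> \<chi> 0 = 1"
  using charactersD(2)[of \<chi> G 0 0] charactersD(1)[of \<chi> G 0] fin_subgroupD(2)[of G] by auto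

lemma finite_characters:
  assumes "fin_subgroup G"
  shows "finite (characters G)"
proof -
  have "characters G \<subseteq> (\<lambda>A x. if x \<in> A \<or> x \<notin> G then 1 else -1) ` Pow G"
  proof
    fix \<chi> assume "\<chi> \<in> characters G"
    then have "\<chi> = (\<lambda>x. if x \<in> {x\<in>G. \<chi> x = 1} \<or> x \<notin> G then 1 else -1)"
      by (intro ext) (auto simp: characters_def)
    then show "\<chi> \<in> (\<lambda>A x. if x \<in> A \<or> x \<notin> G then 1 else -1) ` Pow G" by blast
  qed
  then show ?thesis using fin_subgroupD(1)[OF assms] by (meson finite_Pow_iff finite_imageI finite_subset)
qed

text \<open>Hyperplanes are the kernels of the nontrivial characters: this direction supplies a
  character for a hyperplane, \<open>index2_kernel\<close> a hyperplane for a character.\<close>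

lemma character_of_index2:
  assumes G: "fin_subgroup G" and H: "index2 H G"
  shows "(\<lambda>x. if x \<in> G - H then -1 else 1) \<in> characters G"
proof -
  note p = index2_props[OF G H]
  show ?thesis
    unfolding characters_def
  proof (intro CollectI conjI ballI allI impI)
    fix x y assume xy: "x \<in> G" "y \<in> G"
    have "x + y \<in> G" using xy fin_subgroupD(3)[OF G] by blast
    moreover have "x \<in> H \<Longrightarrow> y \<in> H \<Longrightarrow> x + y \<in> H" using fin_subgroupD(3)[OF p(1)] by blast
    ultimately show "(if x + y \<in> G - H then - 1 else 1) = (if x \<in> G - H then - 1 else 1) * (if y \<in> G - H then - 1 else (1::real))"
      using p(8)[of x y] p(9)[of x y] p(9)[of y x] xy by (auto simp: add.commute)
  qed auto
qed

lemma index2_kernel: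
  assumes G: "fin_subgroup G" and \<chi>: "\<chi> \<in> characters G" "\<chi> \<noteq> (\<lambda>_. 1)"
  shows "index2 {x\<in>G. \<chi> x = 1} G" (is "index2 ?K G")
proof -
  have K: "fin_subgroup ?K"
    using fin_subgroupD[OF G] charactersD[OF \<chi>(1)] character_0[OF G \<chi>(1)]
    by (auto simp: fin_subgroup_def)
  obtain z where "\<chi> z \<noteq> 1" using \<chi>(2) by auto
  then have z: "z \<in> G" "\<chi> z = -1" using charactersD(1,3)[OF \<chi>(1), of z] by auto
  have "y \<in> (+) z ` ?K" if "y \<in> G" "y \<notin> ?K" for y
  proof -
    have "\<chi> (z + y) = 1" "z + y \<in> G"
      using that z charactersD[OF \<chi>(1)] fin_subgroupD(3)[OF G] by fastforce+
    then show ?thesis by (intro image_eqI[of _ _ "z + y"]) auto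
  qed
  then have "G = ?K \<union> (+) z ` ?K" using z(1) fin_subgroupD(3)[OF G] by blast
  then show ?thesis using fin_subgroup_adjoin(3)[OF K, of z] z by simp
qed

lemma sum_character:
  assumes G: "fin_subgroup G" and \<chi>: "\<chi> \<in> characters G" "\<chi> \<noteq> (\<lambda>_. 1)"
  shows "(\<Sum>x\<in>G. \<chi> x) = 0"
proof -
  let ?K = "{x\<in>G. \<chi> x = 1}"
  note p = index2_props[OF G index2_kernel[OF assms]]
  have "(\<Sum>x\<in>G. \<chi> x) = (\<Sum>x\<in>?K. \<chi> x) + (\<Sum>x\<in>G - ?K. \<chi> x)"
    using p(6) by (metis (no_types, lifting) add.commute p(2) sum.subset_diff)
  also have "(\<Sum>x\<in>G - ?K. \<chi> x) = (\<Sum>x\<in>G - ?K. -1)"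
    using charactersD(1)[OF \<chi>(1)] by (intro sum.cong) auto
  finally show ?thesis using p(4) by simp
qed

text \<open>Multiplication by a character \<open>\<psi>\<close> with \<open>\<psi> x = -1\<close>
  permutes the characters and negates the sum.\<close>

lemma character_sum_eq_0:
  assumes G: "fin_subgroup G" and x: "x \<in> G" "x \<noteq> 0"
  shows "(\<Sum>\<chi>\<in>characters G. \<chi> x) = 0"
proof -
  obtain H where H: "index2 H G" "x \<notin> H" using index2_exists[OF assms] by blast
  define \<psi> :: "'a \<Rightarrow> real" where "\<psi> = (\<lambda>x. if x \<in> G - H then -1 else 1)"
  have \<psi>: "\<psi> \<in> characters G" unfolding \<psi>_def by (rule character_of_index2[OF G H(1)])
  have \<psi>x: "\<psi> x = -1" using x H by (simp add: \<psi>_def)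
  have mult: "(\<lambda>y. \<psi> y * \<chi> y) \<in> characters G" if \<chi>: "\<chi> \<in> characters G" for \<chi>
    unfolding characters_def
  proof (intro CollectI conjI ballI allI impI)
    fix y assume "y \<in> G"
    then show "\<psi> y * \<chi> y = 1 \<or> \<psi> y * \<chi> y = -1"
      using charactersD(1)[OF \<chi>, of y] charactersD(1)[OF \<psi>, of y] by auto
  next
    fix y z assume "y \<in> G" "z \<in> G"
    then show "\<psi> (y + z) * \<chi> (y + z) = \<psi> y * \<chi> y * (\<psi> z * \<chi> z)"
      by (simp add: charactersD(2)[OF \<chi>] charactersD(2)[OF \<psi>])
  next
    fix y assume "y \<notin> G"
    then show "\<psi> y * \<chi> y = 1" by (simp add: charactersD(3)[OF \<chi>] charactersD(3)[OF \<psi>])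
  qed
  have sq: "\<psi> y * (\<psi> y * \<chi> y) = \<chi> y" for \<chi> :: "'a \<Rightarrow> real" and y
    by (simp add: \<psi>_def)
  have "(\<Sum>\<chi>\<in>characters G. \<chi> x) = (\<Sum>\<chi>\<in>characters G. \<psi> x * \<chi> x)"
    by (rule sum.reindex_bij_witness[of _ "\<lambda>\<chi> y. \<psi> y * \<chi> y" "\<lambda>\<chi> y. \<psi> y * \<chi> y"]) (auto simp: mult sq)
  also have "\<dots> = - (\<Sum>\<chi>\<in>characters G. \<chi> x)" by (simp add: \<psi>x sum_negf)
  finally show ?thesis by simp
qed

text \<open>Sum all values \<open>\<chi> x\<close> in both orders: in one only \<open>x = 0\<close>
  contributes, in the other only the trivial character.\<close>

lemma card_characters:
  assumes G: "fin_subgroup G"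
  shows "card (characters G) = card G"
proof -
  have "real (card (characters G)) = (\<Sum>x\<in>G. if x = 0 then real (card (characters G)) else 0)"
    using fin_subgroupD[OF G] by simp
  also have "\<dots> = (\<Sum>x\<in>G. \<Sum>\<chi>\<in>characters G. \<chi> x)"
    by (intro sum.cong) (simp_all add: character_sum_eq_0[OF G] character_0[OF G])
  also have "\<dots> = (\<Sum>\<chi>\<in>characters G. \<Sum>x\<in>G. \<chi> x)" by (rule sum.swap)
  also have "\<dots> = (\<Sum>\<chi>\<in>characters G. if \<chi> = (\<lambda>_. 1) then real (card G) else 0)"
    using sum_character[OF G] by (intro sum.cong) auto
  also have "\<dots> = real (card G)" using finite_characters[OF G] by simp
  finally show ?thesis by simp
qed

lemma character_orthogonality:
  assumes "fin_subgroup G" "x \<in> G"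
  shows "(\<Sum>\<chi>\<in>characters G. \<chi> x) = (if x = 0 then real (card G) else 0)"
  using character_sum_eq_0[OF assms] by (simp add: card_characters[OF assms(1)] character_0[OF assms(1)])

section \<open>Fourier coefficients and triangle counts\<close>

definition fourier :: "'a set \<Rightarrow> ('a \<Rightarrow> real) \<Rightarrow> real" where
  "fourier A \<chi> = (\<Sum>x\<in>A. \<chi> x)"

lemma fourier_trivial [simp]: "fourier A (\<lambda>_. 1) = real (card A)"
  by (simp add: fourier_def)

text \<open>Expand the product and sum over the characters first; orthogonality keeps the triples
  with \<open>a + b + c = 0\<close>. With three equal sets this counts triangles.\<close>

lemma fourier_triple:
  assumes G: "fin_subgroup G" and sub: "A \<subseteq> G" "B \<subseteq> G" "C \<subseteq> G"
  shows "(\<Sum>\<chi>\<in>characters G. fourier A \<chi> * fourier B \<chi> * fourier C \<chi>)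
    = real (card G) * (\<Sum>a\<in>A. real (card {b\<in>B. a + b \<in> C}))"
proof -
  have fin: "finite A" "finite B" "finite C" using sub fin_subgroupD(1)[OF G] by (auto intro: finite_subset)
  have "(\<Sum>\<chi>\<in>characters G. fourier A \<chi> * fourier B \<chi> * fourier C \<chi>)
      = (\<Sum>\<chi>\<in>characters G. \<Sum>a\<in>A. \<Sum>b\<in>B. \<Sum>c\<in>C. \<chi> (a + b + c))"
  proof (intro sum.cong refl)
    fix \<chi> assume \<chi>: "\<chi> \<in> characters G"
    have "\<chi> (a + b + c) = \<chi> a * \<chi> b * \<chi> c" if "a \<in> A" "b \<in> B" "c \<in> C" for a b c
    proof -
      have "a \<in> G" "b \<in> G" "c \<in> G" using that sub by auto
      then show ?thesis using charactersD(2)[OF \<chi>] fin_subgroupD(3)[OF G] by simp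
    qed
    then show "fourier A \<chi> * fourier B \<chi> * fourier C \<chi> = (\<Sum>a\<in>A. \<Sum>b\<in>B. \<Sum>c\<in>C. \<chi> (a + b + c))"
      by (simp add: fourier_def mult.assoc flip: sum_distrib_left sum_distrib_right)
  qed
  also have "\<dots> = (\<Sum>a\<in>A. \<Sum>b\<in>B. \<Sum>c\<in>C. \<Sum>\<chi>\<in>characters G. \<chi> (a + b + c))"
    by (simp only: sum.swap[of _ _ "characters G"])
  also have "\<dots> = (\<Sum>a\<in>A. \<Sum>b\<in>B. \<Sum>c\<in>C. if c = a + b then real (card G) else 0)"
  proof (intro sum.cong refl)
    fix a b c assume "a \<in> A" "b \<in> B" "c \<in> C"
    then have "a + b + c \<in> G" using sub fin_subgroupD(3)[OF G] by blast
    then show "(\<Sum>\<chi>\<in>characters G. \<chi> (a + b + c)) = (if c = a + b then real (card G) else 0)"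
      using character_orthogonality[OF G] by auto
  qed
  also have "\<dots> = (\<Sum>a\<in>A. \<Sum>b\<in>B. if a + b \<in> C then real (card G) else 0)"
    using fin by simp
  also have "\<dots> = real (card G) * (\<Sum>a\<in>A. real (card {b\<in>B. a + b \<in> C}))"
    using fin by (simp add: sum_distrib_left sum.If_cases Int_def mult.commute)
  finally show ?thesis .
qed

lemma parseval:
  assumes G: "fin_subgroup G" and A: "A \<subseteq> G"
  shows "(\<Sum>\<chi>\<in>characters G. (fourier A \<chi>)\<^sup>2) = real (card G) * real (card A)"
proof -
  have *: "{b \<in> A. a = b} = {a}" if "a \<in> A" for a using that by auto
  have "(\<Sum>\<chi>\<in>characters G. (fourier A \<chi>)\<^sup>2) = 
    (\<Sum>\<chi>\<in>characters G. fourier A \<chi> * fourier A \<chi> * fourier {0} \<chi>)"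
    using character_0[OF G] by (intro sum.cong) (auto simp: power2_eq_square fourier_def)
  also have "\<dots> = real (card G) * (\<Sum>a\<in>A. real (card {b\<in>A. a + b \<in> {0}}))"
    using fin_subgroupD(2)[OF G] A by (intro fourier_triple[OF G]) auto
  finally show ?thesis by (simp add: *)
qed

lemma fourier_eq:
  assumes G: "fin_subgroup G" and \<chi>: "\<chi> \<in> characters G" and A: "A \<subseteq> G"
  shows "fourier A \<chi> = real (card (A \<inter> {x\<in>G. \<chi> x = 1})) - real (card (A - {x\<in>G. \<chi> x = 1}))"
proof -
  let ?K = "{x\<in>G. \<chi> x = 1}"
  have fin: "finite A" using A fin_subgroupD(1)[OF G] finite_subset by blast
  have "fourier A \<chi> = (\<Sum>x\<in>A \<inter> ?K. \<chi> x) + (\<Sum>x\<in>A - ?K. \<chi> x)"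
    unfolding fourier_def using fin by (rule sum.Int_Diff)
  moreover have "(\<Sum>x\<in>A - ?K. \<chi> x) = (\<Sum>x\<in>A - ?K. -1)"
    using charactersD(1)[OF \<chi>] A by (intro sum.cong) auto
  ultimately show ?thesis by simp
qed

lemma parseval_nontrivial:
  assumes G: "fin_subgroup G" and A: "A \<subseteq> G"
  shows "(\<Sum>\<chi>\<in>characters G - {\<lambda>_. 1}. (fourier A \<chi>)\<^sup>2) = real (card G) * real (card A) - (real (card A))\<^sup>2"
  using parseval[OF assms] finite_characters[OF G]
  by (simp add: sum.remove[of _ "\<lambda>_. 1"])

text \<open>The coefficient at a character with kernel \<open>K\<close> is
  \<open>card E - 2 * card (E - K)\<close>, hence at least \<open>card E - 2 * d\<close>.
  Multiplying by its square and summing with Parseval bounds the cubic sum, to which the trivial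
  character contributes \<open>card E ^ 3\<close>.\<close>

lemma fourier_cube_lower_bound:
  assumes G: "fin_subgroup G" and E: "E \<subseteq> G"
    and bound: "\<And>H. index2 H G \<Longrightarrow> real (card (E - H)) \<le> d"
  shows "real (card E) ^ 3 - (2 * d - real (card E)) * (real (card G) * real (card E) - (real (card E))\<^sup>2)
     \<le> real (card G) * (\<Sum>a\<in>E. real (card {b\<in>E. a + b \<in> E}))"
proof -
  define m where "m = 2 * d - real (card E)"
  define T where "T = (\<Sum>a\<in>E. real (card {b\<in>E. a + b \<in> E}))"
  let ?C = "characters G - {\<lambda>_. 1}"
  have "- m * (fourier E \<chi>)\<^sup>2 \<le> fourier E \<chi> * fourier E \<chi> * fourier E \<chi>"
    if \<chi>: "\<chi> \<in> ?C" for \<chi>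
  proof -
    define K where "K = {x\<in>G. \<chi> x = 1}"
    have K: "index2 K G" unfolding K_def using index2_kernel[OF G] \<chi> by blast
    have "fourier E \<chi> = real (card (E \<inter> K)) - real (card (E - K))"
      using fourier_eq[OF G _ E] \<chi> by (simp add: K_def)
    moreover have "real (card E) = real (card (E \<inter> K)) + real (card (E - K))"
      using index2_card_Un[OF G K E] by linarith
    ultimately have "- m \<le> fourier E \<chi>" using bound[OF K] by (simp add: m_def)
    then have "- m * (fourier E \<chi>)\<^sup>2 \<le> fourier E \<chi> * (fourier E \<chi>)\<^sup>2"
      by (rule mult_right_mono) simp
    then show ?thesis by (simp add: power2_eq_square)
  qed
  then have "(\<Sum>\<chi>\<in>?C. - m * (fourier E \<chi>)\<^sup>2) \<le> (\<Sum>\<chi>\<in>?C. fourier E \<chi> * fourier E \<chi> * fourier E \<chi>)"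
    by (rule sum_mono)
  moreover have "(\<Sum>\<chi>\<in>characters G. fourier E \<chi> * fourier E \<chi> * fourier E \<chi>)
      = real (card E) ^ 3 + (\<Sum>\<chi>\<in>?C. fourier E \<chi> * fourier E \<chi> * fourier E \<chi>)"
    by (subst sum.remove[of _ "\<lambda>_. 1"]) (simp_all add: finite_characters[OF G] power3_eq_cube)
  moreover have "(\<Sum>\<chi>\<in>?C. - m * (fourier E \<chi>)\<^sup>2) = - m * (real (card G) * real (card E) - (real (card E))\<^sup>2)"
    unfolding parseval_nontrivial[OF G E, symmetric] by (rule sum_distrib_left[symmetric])
  ultimately show ?thesis
    unfolding m_def[symmetric] T_def[symmetric] fourier_triple[OF G E E E, folded T_def] by simp
qed

section \<open>Odd relations\<close>

lemma card_sym_diff_nat: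
  assumes "finite X" "finite Y"
  shows "card (sym_diff X Y) + 2 * card (X \<inter> Y) = card X + card Y"
proof -
  have "card X = card (X \<inter> Y) + card (X - Y)"
    using card_Un_disjoint[of "X \<inter> Y" "X - Y"] assms by (simp add: Int_Diff_Un Int_Diff_disjoint)
  moreover have "card Y = card (Y \<inter> X) + card (Y - X)"
    using card_Un_disjoint[of "Y \<inter> X" "Y - X"] assms by (simp add: Int_Diff_Un Int_Diff_disjoint)
  moreover have "card (sym_diff X Y) = card (X - Y) + card (Y - X)"
    using assms by (intro card_Un_disjoint) auto
  ultimately show ?thesis by (simp add: Int_commute)
qed

lemma even_card_sym_diff:
  assumes "finite X" "finite Y" "even (card X)" "even (card Y)"
  shows "even (card (sym_diff X Y))"
  using card_sym_diff_nat[OF assms(1,2)] assms(3,4) by presburger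

lemma sum_sym_diff:
  fixes f :: "'b \<Rightarrow> 'a::elem_2_group"
  assumes "finite X" "finite Y"
  shows "sum f (sym_diff X Y) = sum f X + sum f Y"
proof -
  have "sum f X = sum f (X \<inter> Y) + sum f (X - Y)" "sum f Y = sum f (X \<inter> Y) + sum f (Y - X)"
    using sum.Int_Diff[OF assms(1), of f Y] sum.Int_Diff[OF assms(2), of f X] by (simp_all add: Int_commute)
  moreover have "sum f (sym_diff X Y) = sum f (X - Y) + sum f (Y - X)"
    using assms by (intro sum.union_disjoint) auto
  ultimately show ?thesis by (simp add: ac_simps)
qed

text \<open>Toggling the point \<open>m\<close> exchanges even and odd subsets.\<close>

lemma card_even_subsets:
  "card {X. X \<subseteq> {..<Suc m} \<and> even (card X)} = 2 ^ m"
proof -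
  define \<E> where "\<E> = {X. X \<subseteq> {..<Suc m} \<and> even (card X)}"
  define \<O> where "\<O> = {X. X \<subseteq> {..<Suc m} \<and> odd (card X)}"
  have flip: "even (card (sym_diff X {m})) \<longleftrightarrow> odd (card X)" "sym_diff X {m} \<subseteq> {..<Suc m}"
    if X: "X \<subseteq> {..<Suc m}" for X
  proof -
    have "finite X" using X by (rule finite_subset) simp
    then have "card (sym_diff X {m}) + 2 * card (X \<inter> {m}) = card X + 1"
      using card_sym_diff_nat[of X "{m}"] by simp
    then show "even (card (sym_diff X {m})) \<longleftrightarrow> odd (card X)" by presburger
    show "sym_diff X {m} \<subseteq> {..<Suc m}" using X by auto
  qed
  have invol: "sym_diff (sym_diff X {m}) {m} = X" for X by auto
  have "sym_diff X {m} \<in> \<O>" if "X \<in> \<E>" for X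
    using that flip[of X] unfolding \<E>_def \<O>_def by blast
  moreover have "sym_diff X {m} \<in> \<E>" if "X \<in> \<O>" for X
    using that flip[of X] unfolding \<E>_def \<O>_def by blast
  ultimately have "bij_betw (\<lambda>X. sym_diff X {m}) \<E> \<O>"
    by (intro bij_betw_byWitness[where f' = "\<lambda>X. sym_diff X {m}"]) (simp_all only: invol image_subset_iff, simp_all)
  then have "card \<E> = card \<O>" by (rule bij_betw_same_card)
  moreover have "\<E> \<union> \<O> = Pow {..<Suc m}" "\<E> \<inter> \<O> = {}"
    by (auto simp: \<E>_def \<O>_def)
  moreover from this(1) have "finite \<E>" "finite \<O>"
    by (metis finite_Pow_iff finite_Un finite_lessThan)+
  ultimately have "2 * card \<E> = card (Pow {..<Suc m})"
    by (metis card_Un_disjoint mult_2)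
  then show ?thesis by (simp add: \<E>_def card_Pow)
qed

lemma card_2_eqI: "card S = 2 \<Longrightarrow> x \<in> S \<Longrightarrow> y \<in> S \<Longrightarrow> x \<noteq> y \<Longrightarrow> S = {x, y}"
  by (rule sym, rule card_seteq) (auto intro: card_ge_0_finite)

text \<open>Either all pairs share a point, or the family is contained in a triangle.\<close>
lemma card_intersecting_pairs:
  assumes V: "finite V" "card V \<ge> 4"
    and pairs: "\<And>P. P \<in> \<P> \<Longrightarrow> P \<subseteq> V" "\<And>P. P \<in> \<P> \<Longrightarrow> card P = 2"
    and int: "\<And>P Q. P \<in> \<P> \<Longrightarrow> Q \<in> \<P> \<Longrightarrow> P \<inter> Q \<noteq> {}"
  shows "card \<P> < card V"
proof (cases "\<exists>a\<in>V. \<forall>P\<in>\<P>. a \<in> P")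
  case True
  then obtain a where a: "a \<in> V" "\<And>P. P \<in> \<P> \<Longrightarrow> a \<in> P" by blast
  have "\<P> \<subseteq> (\<lambda>b. {a, b}) ` (V - {a})"
  proof
    fix P assume P: "P \<in> \<P>"
    obtain b where b: "b \<in> P" "b \<noteq> a"
      using pairs(2)[OF P] unfolding card_2_iff by blast
    have "P = {a, b}"
      by (rule card_2_eqI[OF pairs(2)[OF P] a(2)[OF P] b(1)]) (use b in simp)
    then show "P \<in> (\<lambda>b. {a, b}) ` (V - {a})" using b pairs(1)[OF P] by blast
  qed
  then have "card \<P> \<le> card (V - {a})" using V by (intro surj_card_le) simp_all
  also have "\<dots> < card V" by (rule card_Diff1_less[OF V(1) a(1)])
  finally show ?thesis .
next
  case False
  show ?thesis
  proof (cases "\<P> = {}")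
    case True
    then show ?thesis using V by simp
  next
    case nonempty: False
    then obtain P where P: "P \<in> \<P>" by blast
    then obtain a b where ab: "P = {a, b}" "a \<noteq> b" using pairs(2) by (meson card_2_iff)
    have "a \<in> V" "b \<in> V" using pairs(1)[OF P] ab by simp_all
    \<comment> \<open>Without a common point, some \<open>Q\<close> avoids \<open>b\<close> and some
      \<open>R\<close> avoids \<open>a\<close>; pairwise intersection makes \<open>P\<close>,
      \<open>Q\<close>, \<open>R\<close> the sides of a triangle.\<close>
    then obtain Q R where Q: "Q \<in> \<P>" "b \<notin> Q" and R: "R \<in> \<P>" "a \<notin> R" using False by blast
    have aQ: "a \<in> Q" using int[OF P Q(1)] ab Q by blast
    obtain c where c: "c \<in> Q" "c \<noteq> a" using pairs(2)[OF Q(1)] unfolding card_2_iff by blast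
    have Q': "Q = {a, c}" by (rule card_2_eqI[OF pairs(2)[OF Q(1)] aQ c(1)]) (use c in simp)
    have bc: "b \<noteq> c" using Q c by blast
    have "b \<in> R" "c \<in> R" using int[OF P R(1)] int[OF Q(1) R(1)] ab Q' R(2) by blast+
    then have R': "R = {b, c}" by (rule card_2_eqI[OF pairs(2)[OF R(1)] _ _ bc])
    have "\<P> \<subseteq> {{a, b}, {a, c}, {b, c}}"
    proof
      fix S assume S: "S \<in> \<P>"
      have "(a \<in> S \<and> b \<in> S) \<or> (a \<in> S \<and> c \<in> S) \<or> (b \<in> S \<and> c \<in> S)"
        using int[OF S P] int[OF S Q(1)] int[OF S R(1)] unfolding ab(1) Q' R' by blast
      then show "S \<in> {{a, b}, {a, c}, {b, c}}"
        using card_2_eqI[OF pairs(2)[OF S]] ab(2) c(2) bc by (metis insertI1 insertI2)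
    qed
    then have "card \<P> \<le> card {{a, b}, {a, c}, {b, c}}" by (rule card_mono[rotated]) simp
    also have "\<dots> \<le> 3" by (simp add: card_insert_if)
    finally show ?thesis using V by simp
  qed
qed

text \<open>Symmetric difference with a fixed member \<open>Z\<close> turns the other members into
  pairs. Disjoint pairs would come from members at distance four, so the pairs intersect and number
  less than \<open>k\<close>; \<open>Z\<close> adds one.\<close>

lemma card_even_family_le:
  assumes k: "k \<ge> 5" and even: "\<And>X. X \<in> \<X> \<Longrightarrow> X \<subseteq> {..<k} \<and> even (card X)"
    and dist: "\<And>X Y. X \<in> \<X> \<Longrightarrow> Y \<in> \<X> \<Longrightarrow> card (sym_diff X Y) \<le> 2"
  shows "card \<X> \<le> k"
proof (cases "\<X> = {}")
  case False
  then obtain Z where Z: "Z \<in> \<X>" by blast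
  define \<P> where "\<P> = (\<lambda>X. sym_diff X Z) ` (\<X> - {Z})"
  have fin: "finite X" if "X \<in> \<X>" for X using even[OF that] finite_subset by blast
  have finX: "finite \<X>" using even by (intro finite_subset[of \<X> "Pow {..<k}"]) auto
  have two: "card (sym_diff X Z) = 2" if X: "X \<in> \<X>" "X \<noteq> Z" for X
  proof -
    have "even (card (sym_diff X Z))"
      using even_card_sym_diff[OF fin[OF X(1)] fin[OF Z]] even X Z by blast
    moreover have "card (sym_diff X Z) \<noteq> 0" using X fin[OF X(1)] fin[OF Z] by simp
    ultimately show ?thesis using dist[OF X(1) Z] by presburger
  qed
  have "card \<P> < card {..<k}"
  proof (rule card_intersecting_pairs)
    fix P assume "P \<in> \<P>"
    then obtain X where X: "X \<in> \<X>" "X \<noteq> Z" "P = sym_diff X Z" by (auto simp: \<P>_def)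
    show "P \<subseteq> {..<k}" using X even Z by blast
    show "card P = 2" using X by (simp add: two)
  next
    fix P Q assume "P \<in> \<P>" "Q \<in> \<P>"
    then obtain X Y where X: "X \<in> \<X>" "X \<noteq> Z" "P = sym_diff X Z" 
      and Y: "Y \<in> \<X>" "Y \<noteq> Z" "Q = sym_diff Y Z" by (auto simp: \<P>_def)
    show "P \<inter> Q \<noteq> {}"
    proof
      assume disj: "P \<inter> Q = {}"
      then have "sym_diff X Y = P \<union> Q" using X Y by blast
      moreover have "card (P \<union> Q) = card P + card Q" 
        using X Y Z fin disj by (intro card_Un_disjoint) simp_all
      ultimately show False using dist[OF X(1) Y(1)] two[OF X(1,2)] two[OF Y(1,2)] X(3) Y(3) by simp
    qed
  qed (use k in simp_all)
  moreover have "inj_on (\<lambda>X. sym_diff X Z) (\<X> - {Z})" by (auto simp: inj_on_def)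
  then have "card \<P> = card (\<X> - {Z})" unfolding \<P>_def by (rule card_image)
  ultimately show ?thesis using finX Z by (simp add: card_Diff_singleton)
qed simp

text \<open>On each translate of the even span of \<open>c\<close>, a set \<open>S\<close> as below is a family of even subsets
  of \<open>{..<k}\<close> at mutual distance at most two.\<close>
lemma relation_density_bound:
  fixes c :: "nat \<Rightarrow> 'a::elem_2_group"
  assumes k: "k \<ge> 5" and Y: "finite Y" "S \<subseteq> Y"
    and inv: "\<And>y i. y \<in> Y \<Longrightarrow> i < k \<Longrightarrow> y + c i \<in> Y"
    and diff: "\<And>X s t. X \<subseteq> {..<k} \<Longrightarrow> even (card X) \<Longrightarrow> s \<in> S \<Longrightarrow> t \<in> S \<Longrightarrow> s + t = sum c X \<Longrightarrow> card X \<le> 2"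
  shows "2 ^ (k - 1) * card S \<le> k * card Y"
proof -
  let ?\<E> = "{X. X \<subseteq> {..<k} \<and> even (card X)}"
  have card\<E>: "card ?\<E> = 2 ^ (k - 1)" using card_even_subsets[of "k - 1"] k by simp
  have fin\<E>: "finite ?\<E>" by (rule finite_subset[of _ "Pow {..<k}"]) auto
  have inv': "y + sum c X \<in> Y" if "X \<subseteq> {..<k}" "y \<in> Y" for X y
  proof -
    have "finite X" using that finite_subset by blast
    then show ?thesis using that
    proof (induction X arbitrary: y rule: finite_induct)
      case (insert i X)
      then show ?case using inv[of "y + sum c X" i] by (auto simp: ac_simps)
    qed simp
  qed
  \<comment> \<open>Count the pairs \<open>(X, y)\<close> with \<open>y + sum c X\<close> in
    \<open>S\<close>: each \<open>X\<close> gives \<open>card S\<close> of them by translation, each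
    \<open>y\<close> at most \<open>k\<close>.\<close>
  have "2 ^ (k - 1) * card S = (\<Sum>X\<in>?\<E>. card {y\<in>Y. y + sum c X \<in> S})"
  proof -
    have "card {y\<in>Y. y + sum c X \<in> S} = card S" if "X \<in> ?\<E>" for X
    proof -
      have "{y\<in>Y. y + sum c X \<in> S} = (+) (sum c X) ` S"
      proof (intro equalityI subsetI)
        fix y assume "y \<in> {y\<in>Y. y + sum c X \<in> S}"
        then show "y \<in> (+) (sum c X) ` S"
          by (intro image_eqI[of _ _ "y + sum c X"]) (auto simp: add.commute[of y])
      next
        fix y assume "y \<in> (+) (sum c X) ` S"
        then obtain s where s: "s \<in> S" "y = s + sum c X" by (auto simp: add.commute)
        then show "y \<in> {y\<in>Y. y + sum c X \<in> S}" using Y that inv'[of X s] by (auto simp: add.assoc)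
      qed
      then show ?thesis by simp
    qed
    then show ?thesis using card\<E> by simp
  qed
  also have "\<dots> = (\<Sum>y\<in>Y. card {X\<in>?\<E>. y + sum c X \<in> S})"
    using sum_multicount_gen[OF fin\<E> Y(1), of "\<lambda>X y. y + sum c X \<in> S"] by simp
  also have "\<dots> \<le> (\<Sum>y\<in>Y. k)"
  proof (intro sum_mono card_even_family_le[OF k])
    fix y X X' assume X: "X \<in> {X\<in>?\<E>. y + sum c X \<in> S}" "X' \<in> {X\<in>?\<E>. y + sum c X \<in> S}"
    then have fin: "finite X" "finite X'" by (auto intro: finite_subset)
    then have "(y + sum c X) + (y + sum c X') = sum c (sym_diff X X')"
      by (simp add: sum_sym_diff ac_simps)
    then show "card (sym_diff X X') \<le> 2"
      using X fin even_card_sym_diff[OF fin] by (intro diff[of _ "y + sum c X" "y + sum c X'"]) auto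
  qed auto
  finally show ?thesis by (simp add: mult.commute)
qed

section \<open>Existence and shape of odd relations\<close>

definition relation_length :: "'a::elem_2_group set \<Rightarrow> nat \<Rightarrow> bool" where
  "relation_length E k \<longleftrightarrow> (\<exists>cs. length cs = k \<and> set cs \<subseteq> E \<and> sum_list cs = 0)"

lemma even_span_subgroup:
  assumes G: "fin_subgroup G" and E: "E \<subseteq> G"
  defines "L \<equiv> {sum_list cs |cs. set cs \<subseteq> E \<and> even (length cs)}"
  shows "fin_subgroup L" "L \<subseteq> G"
proof -
  have "sum_list cs \<in> G" if "set cs \<subseteq> E" for cs
    using that E fin_subgroupD[OF G] by (induction cs) auto
  then show L: "L \<subseteq> G" unfolding L_def by blast
  have "0 \<in> L" unfolding L_def by (intro CollectI exI[of _ "[]"]) simp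
  moreover have "x + y \<in> L" if xy: "x \<in> L" "y \<in> L" for x y
  proof -
    obtain as bs where "set as \<subseteq> E" "even (length as)" "x = sum_list as"
      "set bs \<subseteq> E" "even (length bs)" "y = sum_list bs" using xy by (auto simp: L_def)
    then show ?thesis unfolding L_def by (intro CollectI exI[of _ "as @ bs"]) simp
  qed
  ultimately show "fin_subgroup L"
    using L fin_subgroupD(1)[OF G] finite_subset by (auto simp: fin_subgroup_def)
qed

text \<open>If \<open>e\<close> in \<open>E\<close> were a sum of evenly many elements of
  \<open>E\<close>, an odd relation would arise; so some hyperplane contains all even sums but not
  \<open>e\<close>. For any \<open>x\<close> in \<open>E\<close>, \<open>e + x\<close> is an even
  sum, so \<open>x\<close> avoids the hyperplane too.\<close>

lemma disjoint_subgroup_if_no_odd_relation: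
  assumes G: "fin_subgroup G" and E: "E \<subseteq> G" "E \<noteq> {}" and rel: "\<And>k. relation_length E k \<Longrightarrow> even k"
  obtains H where "index2 H G" "H \<inter> E = {}"
proof -
  define L where "L = {sum_list cs |cs. set cs \<subseteq> E \<and> even (length cs)}"
  have L: "fin_subgroup L" "L \<subseteq> G" using even_span_subgroup[OF G E(1)] by (simp_all add: L_def)
  obtain e where e: "e \<in> E" using E by blast
  have "e \<notin> L"
  proof
    assume "e \<in> L"
    then obtain cs where cs: "set cs \<subseteq> E" "even (length cs)" "e = sum_list cs" by (auto simp: L_def)
    then have "relation_length E (Suc (length cs))"
      using e unfolding relation_length_def by (intro exI[of _ "e # cs"]) auto
    then show False using rel[of "Suc (length cs)"] cs(2) by simp
  qed
  then obtain H where H: "index2 H G" "L \<subseteq> H" "e \<notin> H"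
    using index2_separating[OF G L] e E(1) by blast
  have "x \<notin> H" if x: "x \<in> E" for x
  proof -
    have "e + x \<in> L" unfolding L_def using e x by (intro CollectI exI[of _ "[e, x]"]) simp
    then show ?thesis
      using H fin_subgroup_add_iff[OF index2_props(1)[OF G H(1)]] by blast
  qed
  then show thesis using that H by blast
qed

text \<open>Records what the density counts use of a shortest odd relation. Lengths one and three
  would mean \<open>0 \<in> E\<close> or a triangle.\<close>

definition reduced_odd_relation :: "'a::elem_2_group set \<Rightarrow> nat \<Rightarrow> (nat \<Rightarrow> 'a) \<Rightarrow> bool" where
  "reduced_odd_relation E k c \<longleftrightarrow> odd k \<and> 5 \<le> k \<and> (\<forall>i<k. c i \<in> E) \<and> sum c {..<k} = 0 \<and>
    (\<forall>X s t. X \<subseteq> {..<k} \<longrightarrow> even (card X) \<longrightarrow> s \<in> E \<longrightarrow> t \<in> E \<longrightarrow> s + t = sum c X \<longrightarrow> card X \<le> 2)"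

lemma reduced_odd_relationD:
  assumes "reduced_odd_relation E k c"
  shows "odd k" "5 \<le> k" "i < k \<Longrightarrow> c i \<in> E" "sum c {..<k} = 0"
    "X \<subseteq> {..<k} \<Longrightarrow> even (card X) \<Longrightarrow> s \<in> E \<Longrightarrow> t \<in> E \<Longrightarrow> s + t = sum c X \<Longrightarrow> card X \<le> 2"
  using assms unfolding reduced_odd_relation_def by blast+

text \<open>In a shortest odd relation of length \<open>k\<close>, replacing an even subset \<open>X\<close> of the terms by
  two elements \<open>s\<close>, \<open>t\<close> with the same sum and passing to the complement of \<open>X\<close> gives an odd
  relation of length \<open>k - card X + 2\<close>.\<close>
lemma reduced_odd_relation_exists:
  assumes "relation_length E n" "odd n" "0 \<notin> E" and tri: "\<And>x y. x \<in> E \<Longrightarrow> y \<in> E \<Longrightarrow> x + y \<notin> E"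
  shows "\<exists>k c. reduced_odd_relation E k c"
proof -
  define k where "k = (LEAST k. relation_length E k \<and> odd k)"
  have "relation_length E k \<and> odd k"
    unfolding k_def by (rule LeastI[of _ n]) (simp add: assms)
  then have k: "relation_length E k" "odd k" by simp_all
  have least: "k \<le> j" if "relation_length E j" "odd j" for j
    unfolding k_def using that by (intro Least_le) simp
  obtain cs where cs: "length cs = k" "set cs \<subseteq> E" "sum_list cs = 0"
    using k(1) by (auto simp: relation_length_def)
  define c where "c = (!) cs"
  have cE: "c i \<in> E" if "i < k" for i using that cs nth_mem unfolding c_def by blast
  have sum0: "sum c {..<k} = 0"
    using cs by (simp add: c_def sum_list_sum_nth lessThan_atLeast0)
  have "k \<noteq> 1"
  proof
    assume "k = 1"
    then show False using sum0 cE[of 0] assms(3) by simp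
  qed
  moreover have "k \<noteq> 3"
  proof
    assume "k = 3"
    then have "c 0 + c 1 = c 2" using sum0 by (simp add: eval_nat_numeral)
    then show False using tri[of "c 0" "c 1"] cE[of 0] cE[of 1] cE[of 2] \<open>k = 3\<close> by simp
  qed
  ultimately have k5: "k \<ge> 5" using \<open>odd k\<close> by presburger
  have short: "card X \<le> 2" if X: "X \<subseteq> {..<k}" "even (card X)" and st: "s \<in> E" "t \<in> E" "s + t = sum c X" for X s t
  proof -
    let ?X = "{..<k} - X"
    let ?l = "s # t # map c (sorted_list_of_set ?X)"
    have "sum c {..<k} = sum c X + sum c ?X"
      using sum.subset_diff[OF X(1), of c] by (simp add: add.commute)
    then have "sum c ?X = s + t" using sum0 st by simp
    then have "sum_list ?l = 0"
      by (simp add: sum_list_distinct_conv_sum_set ac_simps)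
    moreover have len: "length ?l = k - card X + 2"
      using X by (simp add: card_Diff_subset finite_subset[of X "{..<k}"])
    moreover have "set ?l \<subseteq> E" using st cE by auto
    ultimately have "relation_length E (k - card X + 2)" unfolding relation_length_def by blast
    moreover have "card X \<le> k" using X by (metis card_lessThan card_mono finite_lessThan)
    moreover have "odd (k - card X + 2)" using \<open>odd k\<close> X \<open>card X \<le> k\<close> by simp
    ultimately show ?thesis using least[of "k - card X + 2"] by linarith
  qed
  have "reduced_odd_relation E k c"
    unfolding reduced_odd_relation_def using k(2) k5 cE sum0 short by simp
  then show ?thesis by blast
qed

section \<open>Triangle-free sets\<close>

lemma density_le_trans:
  fixes p k s g d n :: nat
  assumes "p * s \<le> k * g" "d * k \<le> n * p" "p > 0"
  shows "d * s \<le> n * g"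
proof -
  have "p * (d * s) = d * (p * s)" by (rule mult.left_commute)
  also have "\<dots> \<le> d * (k * g)" using assms(1) by (rule mult_le_mono2)
  also have "\<dots> = (d * k) * g" by (rule mult.assoc[symmetric])
  also have "\<dots> \<le> (n * p) * g" using assms(2) by (rule mult_le_mono1)
  also have "\<dots> = p * (n * g)" by (simp add: ac_simps)
  finally show ?thesis using assms(3) by simp
qed

text \<open>From the base case \<open>m\<close> on, each step adds \<open>d\<close> on the left and
  doubles the right side, which is at least \<open>d\<close>.\<close>

lemma linear_le_power2:
  fixes d n :: nat
  assumes "d * m \<le> n * 2 ^ (m - 1)" "d \<le> n * 2 ^ (m - 1)" "m > 0" "m \<le> k"
  shows "d * k \<le> n * 2 ^ (k - 1)"
  using assms(4)
proof (induction k rule: dec_induct)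
  case (step j)
  have "(2::nat) ^ (m - 1) \<le> 2 ^ (j - 1)" using step by (intro power_increasing) simp_all
  then have "n * 2 ^ (m - 1) \<le> n * 2 ^ (j - 1)" by (rule mult_le_mono2)
  moreover have "d * Suc j = d * j + d" by simp
  ultimately have "d * Suc j \<le> 2 * (n * 2 ^ (j - 1))" using step.IH assms(2) by linarith
  also have "\<dots> = n * 2 ^ (Suc j - 1)" using step assms(3) by (cases j) simp_all
  finally show ?case .
qed (rule assms(1))

text \<open>A reduced relation of length \<open>k\<close> limits the density to
  \<open>k / 2 ^ (k - 1)\<close>, which for \<open>k \<ge> 5\<close> is largest at
  \<open>k = 5\<close>, where it is 5/16.\<close>

lemma triangle_free_not_affine_density:
  assumes G: "fin_subgroup G" and E: "E \<subseteq> G" "0 \<notin> E"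
    and tri: "\<And>x y. x \<in> E \<Longrightarrow> y \<in> E \<Longrightarrow> x + y \<notin> E"
    and rel: "relation_length E n" "odd n"
  shows "16 * card E \<le> 5 * card G"
proof -
  obtain k c where kc: "reduced_odd_relation E k c"
    using reduced_odd_relation_exists[OF rel E(2) tri] by blast
  note k = reduced_odd_relationD(1-3)[OF kc] and diff = reduced_odd_relationD(5)[OF kc]
  have "y + c i \<in> G" if "y \<in> G" "i < k" for y i
    using fin_subgroupD(3)[OF G that(1)] k(3)[OF that(2)] E(1) by blast
  then have "2 ^ (k - 1) * card E \<le> k * card G"
    by (rule relation_density_bound[OF k(2) fin_subgroupD(1)[OF G] E(1) _ diff])
  moreover have "16 * k \<le> 5 * 2 ^ (k - 1)"
    by (rule linear_le_power2[OF _ _ _ k(2)]) simp_all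
  ultimately show ?thesis by (rule density_le_trans) simp
qed

text \<open>Applied to the part of a triangle-free set in a hyperplane \<open>H\<close>, when its shortest odd relation
  has length at least seven, and to a translate \<open>A\<close> into \<open>H\<close> of the part outside \<open>H\<close>. The Fourier
  coefficients of \<open>A\<close> are small because an element of \<open>E \<inter> K\<close> forces \<open>A\<close> to fill at most half of
  each coset of \<open>K\<close>; if \<open>A\<close> were almost half of \<open>H\<close>, this would contradict
  \<open>A \<inter> (A + E) = {}\<close>.\<close>
lemma sparse_translates_bound:
  assumes H: "fin_subgroup H" and sub: "A \<subseteq> H" "E \<subseteq> H"
    and disj: "\<And>a e. a \<in> A \<Longrightarrow> e \<in> E \<Longrightarrow> a + e \<notin> A"
    and E: "64 * card E \<le> 7 * card H" "E \<noteq> {}" "0 \<notin> E"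
    and meet: "\<And>K. index2 K H \<Longrightarrow> K \<inter> E \<noteq> {}"
  shows "2 * (card A + card E) \<le> card H"
proof (rule ccontr)
  assume "\<not> ?thesis"
  then have large: "card H < 2 * (card A + card E)" by simp
  define N a e where "N = real (card H)" and "a = real (card A)" and "e = real (card E)"
  have Npos: "N > 0" using fin_subgroup_card_pos[OF H] by (simp add: N_def)
  have fin: "finite H" "finite A" "finite E" using fin_subgroupD(1)[OF H] sub by (auto intro: finite_subset)
  have epos: "e > 0" using E(2) fin by (auto simp: e_def card_gt_0_iff)
  let ?C = "characters H - {\<lambda>_. 1}"
  have bound: "\<bar>fourier A \<chi>\<bar> \<le> N / 2 - a" if \<chi>: "\<chi> \<in> ?C" for \<chi>
  proof -
    let ?K = "{x\<in>H. \<chi> x = 1}"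
    have K: "index2 ?K H" using index2_kernel[OF H] \<chi> by auto
    note p = index2_props[OF H K]
    obtain w where w: "w \<in> ?K" "w \<in> E" using meet[OF K] by blast
    \<comment> \<open>As \<open>w\<close> lies in \<open>E\<close>, a part \<open>B\<close> of
      \<open>A\<close> is disjoint from its translate by \<open>w\<close>, and both fit into the set
      \<open>Z\<close> stable under \<open>w\<close>.\<close>
    have half: "2 * card B \<le> card ?K" if B: "B \<subseteq> A" "B \<subseteq> Z" "card Z = card ?K" "finite Z"
      "\<And>z. z \<in> Z \<Longrightarrow> w + z \<in> Z" for B Z
    proof -
      have "B \<inter> (+) w ` B = {}" using disj[OF _ w(2)] B(1) by (auto simp: add.commute)
      then have "card (B \<union> (+) w ` B) = 2 * card B"
        using B fin by (subst card_Un_disjoint) (auto intro: finite_subset)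
      moreover have "card (B \<union> (+) w ` B) \<le> card Z" using B by (intro card_mono) auto
      ultimately show ?thesis using B by simp
    qed
    have "2 * card (A \<inter> ?K) \<le> card ?K"
      using p(7) fin_subgroupD(3)[OF p(1) w(1)] by (intro half[of _ ?K]) auto
    moreover have "2 * card (A - ?K) \<le> card ?K"
      using p(4,6) p(9)[OF w(1)] sub by (intro half[of _ "H - ?K"]) auto
    ultimately have "real (card (A \<inter> ?K)) \<le> N / 4" "real (card (A - ?K)) \<le> N / 4"
      using p(3) by (auto simp: N_def)
    then show ?thesis
      using fourier_eq[OF H _ sub(1), of \<chi>] index2_card_Un[OF H K sub(1)] \<chi> by (simp add: a_def)
  qed
  \<comment> \<open>Some nontrivial character exists, so the bound on its coefficient shows that
    \<open>N / 2 - a\<close> is not negative.\<close>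
  have "\<exists>x. x \<in> H \<and> x \<noteq> 0" using E(2,3) sub by blast
  then obtain x where x: "x \<in> H" "x \<noteq> 0" by blast
  obtain K where K: "index2 K H" "x \<notin> K" using index2_exists[OF H x] by blast
  have "(\<lambda>y. if y \<in> H - K then -1 else 1) \<in> ?C"
    using character_of_index2[OF H K(1)] x K by (auto simp: fun_eq_iff)
  from bound[OF this] have m0: "N / 2 - a \<ge> 0" by simp
  \<comment> \<open>No two elements of \<open>A\<close> sum to an element of \<open>E\<close>, so
    the nontrivial characters must cancel the term \<open>a\<^sup>2 * e\<close> of the trivial
    one.\<close>
  have "0 = (\<Sum>\<chi>\<in>characters H. fourier A \<chi> * fourier A \<chi> * fourier E \<chi>)"
  proof -
    have "(\<Sum>x\<in>A. real (card {y\<in>A. x + y \<in> E})) = 0"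
    proof (intro sum.neutral ballI)
      fix x assume x: "x \<in> A"
      have "x + y \<notin> E" if "y \<in> A" for y using disj[OF x, of "x + y"] that by auto
      then have "{y\<in>A. x + y \<in> E} = {}" by blast
      then show "real (card {y\<in>A. x + y \<in> E}) = 0" by (simp only: card.empty of_nat_0)
    qed
    then show ?thesis by (simp add: fourier_triple[OF H sub(1,1,2)])
  qed
  then have "a\<^sup>2 * e = - (\<Sum>\<chi>\<in>?C. fourier A \<chi> * fourier A \<chi> * fourier E \<chi>)"
    using finite_characters[OF H] by (simp add: sum.remove[of _ "\<lambda>_. 1"] a_def e_def power2_eq_square)
  also have "\<dots> \<le> (\<Sum>\<chi>\<in>?C. (N / 2 - a) * (\<bar>fourier A \<chi>\<bar> * \<bar>fourier E \<chi>\<bar>))"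
    unfolding sum_negf[symmetric]
  proof (intro sum_mono)
    fix \<chi> assume "\<chi> \<in> ?C"
    have "- (fourier A \<chi> * fourier A \<chi> * fourier E \<chi>) \<le> \<bar>fourier A \<chi>\<bar> * (\<bar>fourier A \<chi>\<bar> * \<bar>fourier E \<chi>\<bar>)"
      by (metis abs_ge_minus_self abs_mult mult.assoc)
    also have "\<dots> \<le> (N / 2 - a) * (\<bar>fourier A \<chi>\<bar> * \<bar>fourier E \<chi>\<bar>)"
      using bound[OF \<open>\<chi> \<in> ?C\<close>] by (intro mult_right_mono) auto
    finally show "- (fourier A \<chi> * fourier A \<chi> * fourier E \<chi>) \<le> (N / 2 - a) * (\<bar>fourier A \<chi>\<bar> * \<bar>fourier E \<chi>\<bar>)" .
  qed
  finally have 1: "a\<^sup>2 * e \<le> (N / 2 - a) * (\<Sum>\<chi>\<in>?C. \<bar>fourier A \<chi>\<bar> * \<bar>fourier E \<chi>\<bar>)"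
    by (simp add: sum_distrib_left)
  define S where "S = (\<Sum>\<chi>\<in>?C. \<bar>fourier A \<chi>\<bar> * \<bar>fourier E \<chi>\<bar>)"
  have S0: "S \<ge> 0" unfolding S_def by (intro sum_nonneg) auto
  have "S\<^sup>2 \<le> (\<Sum>\<chi>\<in>?C. \<bar>fourier A \<chi>\<bar>\<^sup>2) * (\<Sum>\<chi>\<in>?C. \<bar>fourier E \<chi>\<bar>\<^sup>2)"
    unfolding S_def by (rule Cauchy_Schwarz_ineq_sum)
  also have "\<dots> = (N * a - a\<^sup>2) * (N * e - e\<^sup>2)"
    unfolding power2_abs using parseval_nontrivial[OF H sub(1)] parseval_nontrivial[OF H sub(2)]
    by (simp add: N_def a_def e_def)
  finally have 2: "S\<^sup>2 \<le> (N * a - a\<^sup>2) * (N * e - e\<^sup>2)" .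
  have "real (card H) < real (2 * (card A + card E))" using large by (simp only: of_nat_less_iff)
  then have "N < 2 * (a + e)" by (simp add: N_def a_def e_def)
  then have lt: "N / 2 - a < e" by simp
  have e7: "64 * e \<le> 7 * N" using E(1) unfolding N_def e_def by linarith
  have a25: "64 * a > 25 * N" using lt e7 by simp
  have "a\<^sup>2 * e \<le> e * S" using 1 lt S0 unfolding S_def[symmetric]
    by (smt (verit) mult_right_mono)
  then have "a\<^sup>2 \<le> S" using epos by (simp add: mult.commute)
  then have "(a\<^sup>2)\<^sup>2 \<le> S\<^sup>2" by (intro power_mono) auto
  with 2 have "a * a ^ 3 \<le> a * ((N - a) * (e * (N - e)))"
    by (simp add: power2_eq_square power3_eq_cube algebra_simps)
  moreover have "a > 0" using a25 Npos by linarith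
  ultimately have 3: "a ^ 3 \<le> (N - a) * (e * (N - e))" by simp
  \<comment> \<open>The right side of \<open>3\<close> is at most its value at
    \<open>a = 25/64 * N\<close> and \<open>e = 7/64 * N\<close>, since \<open>x * (N - x)\<close>
    increases up to \<open>N / 2\<close>. The contradiction is \<open>25 ^ 3 = 15625\<close> against
    \<open>39 * 7 * 57 = 15561\<close>.\<close>
  have "(25 / 64 * N) ^ 3 \<le> a ^ 3" using a25 Npos by (intro power_mono) auto
  also note 3
  also have "(N - a) * (e * (N - e)) \<le> (39 / 64 * N) * (7 / 64 * N * (57 / 64 * N))"
  proof (rule mult_mono)
    have "(7 / 64 * N - e) * (57 / 64 * N - e) \<ge> 0" using e7 Npos by (intro mult_nonneg_nonneg) auto
    moreover have "(7 / 64 * N - e) * (57 / 64 * N - e) = 7 / 64 * N * (57 / 64 * N) - e * (N - e)"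
      by (simp add: field_simps)
    ultimately show "e * (N - e) \<le> 7 / 64 * N * (57 / 64 * N)" by linarith
    show "0 \<le> e * (N - e)" using epos e7 Npos by simp
  qed (use a25 Npos in auto)
  finally have "15625 / 262144 * N ^ 3 \<le> 15561 / 262144 * N ^ 3"
    by (simp add: power_mult_distrib power3_eq_cube power_divide)
  then show False using zero_less_power[OF Npos, of 3] by linarith
qed

theorem triangle_free_codim2:
  assumes G: "fin_subgroup G" and E: "E \<subseteq> G" "0 \<notin> E"
    and tri: "\<And>x y. x \<in> E \<Longrightarrow> y \<in> E \<Longrightarrow> x + y \<notin> E"
    and dense: "4 * card E > card G"
  obtains U where "fin_subgroup U" "U \<subseteq> G" "card G \<le> 4 * card U" "U \<inter> E = {}"
proof (rule ccontr)
  assume "\<not> thesis"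
  then have no: "\<not> (fin_subgroup U \<and> U \<subseteq> G \<and> card G \<le> 4 * card U \<and> U \<inter> E = {})" for U
    using that by blast
  \<comment> \<open>If the odd relation found in \<open>E \<inter> H\<close> has length five, it
    limits the density of \<open>E\<close> off \<open>H\<close> to 5/16, that is 5/32 of
    \<open>G\<close>; a longer one would make all of \<open>E\<close> too sparse.\<close>
  have outside: "32 * card (E - H) \<le> 5 * card G" if H: "index2 H G" for H
  proof -
    note p = index2_props[OF G H]
    define E0 where "E0 = E \<inter> H"
    have meet: "K \<inter> E0 \<noteq> {}" if "index2 K H" for K
      using no[of K] index2_props[OF p(1) that] p(2,3) by (auto simp: E0_def)
    have "E0 \<noteq> {}" using no[of H] p by (auto simp: E0_def)
    have E0: "E0 \<subseteq> H" "0 \<notin> E0" using E by (auto simp: E0_def)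
    have tri0: "x + y \<notin> E0" if "x \<in> E0" "y \<in> E0" for x y using tri[of x y] that by (auto simp: E0_def)
    obtain n where n: "relation_length E0 n" "odd n"
    proof (rule ccontr)
      assume no_odd: "\<not> thesis"
      have "even m" if "relation_length E0 m" for m using no_odd \<open>\<And>n. relation_length E0 n \<Longrightarrow> odd n \<Longrightarrow> thesis\<close> that by blast
      then obtain K where "index2 K H" "K \<inter> E0 = {}"
        using disjoint_subgroup_if_no_odd_relation[OF p(1) E0(1) \<open>E0 \<noteq> {}\<close>] by blast
      then show False using meet by blast
    qed
    obtain k c where kc: "reduced_odd_relation E0 k c"
      using reduced_odd_relation_exists[OF n E0(2) tri0] by blast
    note k = reduced_odd_relationD(1-3)[OF kc] and sum0 = reduced_odd_relationD(4)[OF kc]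
      and diff = reduced_odd_relationD(5)[OF kc]
    show ?thesis
    proof (cases "k = 5")
      case True
      have "2 ^ (k - 1) * card (E - H) \<le> k * card (G - H)"
      proof (rule relation_density_bound[OF k(2), where c = c])
        show "finite (G - H)" "E - H \<subseteq> G - H" using p(6) E by auto
        show "y + c i \<in> G - H" if "y \<in> G - H" "i < k" for y i
          using p(9)[of "c i" y] that k(3) E0 by (auto simp: add.commute)
      next
        fix X s t assume X: "X \<subseteq> {..<k}" "even (card X)" and st: "s \<in> E - H" "t \<in> E - H" "s + t = sum c X"
        \<comment> \<open>The five terms sum to zero, so four of them sum to the fifth, which would
          form a triangle with \<open>s\<close> and \<open>t\<close>.\<close>
        show "card X \<le> 2"
        proof (rule ccontr)
          assume "\<not> card X \<le> 2"
          moreover have "card X \<le> k" using X by (metis card_lessThan card_mono finite_lessThan)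
          ultimately have "card X = 4" using True X by presburger
          then have "card ({..<k} - X) = 1"
            using X True by (simp add: card_Diff_subset finite_subset[of X "{..<k}"])
          then obtain i where i: "{..<k} - X = {i}" by (auto simp: card_1_singleton_iff)
          have "sum c {..<k} = sum c X + sum c ({..<k} - X)"
            using X by (metis add.commute finite_lessThan sum.subset_diff)
          then have "s + t = c i" using sum0 st i by simp
          moreover have "c i \<in> E0" using i k(3) by blast
          ultimately show False using tri[of s t] st by (auto simp: E0_def)
        qed
      qed
      then show ?thesis using p True by simp
    next
      case False
      then have k7: "k \<ge> 7" using k by presburger
      have "y + c i \<in> H" if "y \<in> H" "i < k" for y i
        using fin_subgroupD(3)[OF p(1) that(1)] k(3)[OF that(2)] E0(1) by blast
      then have "2 ^ (k - 1) * card E0 \<le> k * card H"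
        by (rule relation_density_bound[OF k(2) p(7) E0(1) _ diff])
      moreover have "64 * k \<le> 7 * 2 ^ (k - 1)"
        by (rule linear_le_power2[OF _ _ _ k7]) simp_all
      ultimately have sparse: "64 * card E0 \<le> 7 * card H" by (rule density_le_trans) simp
      obtain g where g: "g \<in> G - H" using p(5) by blast
      define A where "A = (+) g ` (E - H)"
      have "2 * (card A + card E0) \<le> card H"
      proof (rule sparse_translates_bound[OF p(1) _ E0(1) _ sparse \<open>E0 \<noteq> {}\<close> E0(2) meet])
        show "A \<subseteq> H" using p(8)[OF g] E by (auto simp: A_def)
        show "a + e \<notin> A" if ae: "a \<in> A" "e \<in> E0" for a e
        proof
          assume "a + e \<in> A"
          then obtain s t where st: "s \<in> E" "t \<in> E" "a = g + s" "a + e = g + t" using ae by (auto simp: A_def)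
          then have "s + e = t" by (simp add: add.assoc)
          then show False using tri[of s e] st ae by (auto simp: E0_def)
        qed
      qed
      then have "4 * card E \<le> card G"
        using index2_card_Un[OF G H E(1)] p(3) by (simp add: A_def E0_def)
      then show ?thesis using dense by simp
    qed
  qed
  define N a where "N = real (card G)" and "a = real (card E)"
  have dense': "4 * a > N" using dense unfolding N_def a_def by linarith
  have Npos: "N > 0" using fin_subgroup_card_pos[OF G] by (simp add: N_def)
  have "real (card (E - H)) \<le> 5 / 32 * N" if "index2 H G" for H
    using outside[OF that] by (simp add: N_def)
  from fourier_cube_lower_bound[OF G E(1) this]
  have "a ^ 3 - (2 * (5 / 32 * N) - a) * (N * a - a\<^sup>2) \<le> N * (\<Sum>x\<in>E. real (card {y\<in>E. x + y \<in> E}))"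
    by (simp add: N_def a_def)
  also have "(\<Sum>x\<in>E. real (card {y\<in>E. x + y \<in> E})) = 0"
  proof (intro sum.neutral ballI)
    fix x assume "x \<in> E"
    then have "{y\<in>E. x + y \<in> E} = {}" using tri by auto
    then show "real (card {y\<in>E. x + y \<in> E}) = 0" by (simp only: card.empty of_nat_0)
  qed
  \<comment> \<open>At density 1/4 the bracket is already positive: 21/64 against 20/64.\<close>
  finally have "a * N * (21 / 16 * a - 5 / 16 * N) \<le> 0"
    by (simp add: power2_eq_square power3_eq_cube algebra_simps)
  moreover have "a * N * (21 / 16 * a - 5 / 16 * N) > 0" using dense' Npos by (intro mult_pos_pos) auto
  ultimately show False by simp
qed

section \<open>Sets without large geometries\<close>

text \<open>A subgroup of order \<open>2 ^ s\<close> is a copy of the space \<open>F_2^s\<close>, so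
  this is containment of \<open>PG(s - 1, 2)\<close>; the index is the rank.\<close>

definition has_geometry :: "nat \<Rightarrow> 'a::elem_2_group set \<Rightarrow> bool" where
  "has_geometry s E \<longleftrightarrow> (\<exists>W. fin_subgroup W \<and> card W = 2 ^ s \<and> W - {0} \<subseteq> E)"

lemma adjoin_coset_geometry:
  assumes W: "fin_subgroup W" "card W = 2 ^ s" "W - {0} \<subseteq> E" and y: "y \<notin> W" "\<And>w. w \<in> W \<Longrightarrow> y + w \<in> E"
  shows "has_geometry (Suc s) E"
proof -
  let ?U = "W \<union> (+) y ` W"
  have "?U - {0} \<subseteq> E" using W y by auto
  then show ?thesis
    using fin_subgroup_adjoin(1,2)[OF W(1) y(1)] W(2) unfolding has_geometry_def
    by (intro exI[of _ ?U]) simp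
qed

lemma pair_generates:
  fixes x y :: "'a::elem_2_group"
  assumes "x \<noteq> 0" "y \<noteq> 0" "x \<noteq> y"
  shows "fin_subgroup {0, x, y, x + y}" "card {0, x, y, x + y} = 4"
proof -
  have K: "fin_subgroup {0, x}" by (simp add: fin_subgroup_def)
  have "y \<notin> {0, x}" using assms by simp
  from fin_subgroup_adjoin(1,2)[OF K this]
  have "fin_subgroup ({0, x} \<union> {y, y + x})" "card ({0, x} \<union> {y, y + x}) = 2 * card {0, x}" by simp_all
  moreover have "{0, x} \<union> {y, y + x} = {0, x, y, x + y}" by (simp add: add.commute insert_commute)
  ultimately show "fin_subgroup {0, x, y, x + y}" "card {0, x, y, x + y} = 4" using assms(1) by simp_all
qed

lemma triangle_has_geometry:
  assumes "0 \<notin> E" "x \<in> E" "y \<in> E" "x + y \<in> E"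
  shows "has_geometry 2 E"
proof -
  have "x \<noteq> 0" "y \<noteq> 0" "x \<noteq> y" using assms by auto
  from pair_generates[OF this] show ?thesis
    using assms unfolding has_geometry_def by (intro exI[of _ "{0, x, y, x + y}"]) auto
qed

text \<open>Every coset of \<open>W\<close> contains a point outside \<open>E\<close>: otherwise that coset would extend \<open>W\<close>
  to a larger geometry.\<close>
lemma complement_card_of_geometry:
  assumes H: "fin_subgroup H" and W: "fin_subgroup W" "W \<subseteq> H" "card W = 2 ^ s" "W - {0} \<subseteq> E"
    and E: "0 \<notin> E" "\<not> has_geometry (Suc s) E"
    and Y: "finite Y" "\<And>y h. y \<in> Y \<Longrightarrow> h \<in> H \<Longrightarrow> y + h \<in> Y"
  shows "card Y \<le> card (Y - E) * 2 ^ s"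
proof -
  have "\<exists>w\<in>W. y + w \<in> Y - E" if y: "y \<in> Y" for y
  proof (cases "y \<in> W")
    case True
    have "y + y \<notin> E" using E(1) by simp
    then show ?thesis using True y Y(2)[OF y, of y] W(2) by blast
  next
    case False
    then obtain w where "w \<in> W" "y + w \<notin> E"
      using adjoin_coset_geometry[OF W(1,3,4) False] E(2) by blast
    then show ?thesis using y Y(2)[OF y, of w] W(2) by blast
  qed
  then have "card Y \<le> card ((Y - E) \<inter> Y) * card W"
    using Y W(2) fin_subgroupD(1)[OF W(1)] by (intro card_le_card_times_meeting) blast+
  then show ?thesis using W(3) by (simp add: Int_absorb2)
qed

text \<open>The count over the cosets of \<open>W\<close> applies to \<open>H\<close> and to
  \<open>G - H\<close>, as both are stable under \<open>H\<close>.\<close>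

lemma hyperplane_complement_bounds:
  assumes G: "fin_subgroup G" and H: "index2 H G"
    and W: "has_geometry s (E \<inter> H)" and E: "0 \<notin> E" "\<not> has_geometry (Suc s) E"
  shows "card H \<le> card (H - E) * 2 ^ s" "card H \<le> card (G - H - E) * 2 ^ s"
proof -
  note p = index2_props[OF G H]
  obtain W where W: "fin_subgroup W" "card W = 2 ^ s" "W - {0} \<subseteq> E \<inter> H"
    using W unfolding has_geometry_def by blast
  have WH: "W \<subseteq> H" using W(3) fin_subgroupD(2)[OF p(1)] by auto
  have WE: "W - {0} \<subseteq> E" using W(3) by blast
  note bound = complement_card_of_geometry[OF p(1) W(1) WH W(2) WE E]
  show "card H \<le> card (H - E) * 2 ^ s"
    by (rule bound[OF p(7) fin_subgroupD(3)[OF p(1)]])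
  have "card (G - H) \<le> card (G - H - E) * 2 ^ s"
  proof (rule bound)
    show "y + h \<in> G - H" if "y \<in> G - H" "h \<in> H" for y h
      using p(9)[OF that(2,1)] by (simp add: add.commute)
  qed (use p(6) in simp)
  then show "card H \<le> card (G - H - E) * 2 ^ s" using p(4) by simp
qed

lemma hyperplane_triangle_free:
  assumes G: "fin_subgroup G" and E: "E \<subseteq> G" "0 \<notin> E" and free: "\<not> has_geometry 3 E"
    and dense: "5 * card G < 8 * card E"
  shows "\<exists>H. index2 H G \<and> \<not> has_geometry 2 (E \<inter> H)"
proof (rule ccontr)
  assume "\<not> ?thesis"
  then have geo: "has_geometry 2 (E \<inter> H)" if "index2 H G" for H using that by blast
  have free': "\<not> has_geometry (Suc 2) E" using free by (simp add: numeral_3_eq_3 numeral_2_eq_2)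
  have finG: "finite G" and finE: "finite E" using fin_subgroupD(1)[OF G] E(1) finite_subset by auto
  have bounds: "card H \<le> card (H - E) * 4" "card H \<le> card (G - H - E) * 4" if H: "index2 H G" for H
    using hyperplane_complement_bounds[OF G H geo[OF H] E(2) free'] by simp_all
  have cardGE: "card (G - E) + card E = card G"
    using finG E(1) by (simp add: card_Diff_subset finE card_mono)
  \<comment> \<open>The set bounded here, called \<open>F\<close> below, counts the triangles
    through \<open>v\<close>. A triangle inside \<open>F\<close> would generate with
    \<open>v\<close> a rank three geometry in \<open>E\<close>.\<close>
  have local: "16 * card {y\<in>E. v + y \<in> E} \<le> 5 * card G" if v: "v \<in> E" for v
  proof -
    define F where "F = {y\<in>E. v + y \<in> E}"
    have F: "F \<subseteq> G" "0 \<notin> F" "finite F" using E finE by (auto simp: F_def)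
    have vG: "v \<in> G" using v E by blast
    have shift: "v + y \<in> F \<longleftrightarrow> y \<in> F" for y by (auto simp: F_def)
    have tri: "x + y \<notin> F" if xy: "x \<in> F" "y \<in> F" for x y
    proof
      assume "x + y \<in> F"
      then have in_E: "x \<in> E" "y \<in> E" "x + y \<in> E" "v + x \<in> E" "v + y \<in> E" "v + (x + y) \<in> E"
        using xy by (auto simp: F_def)
      then have ne: "x \<noteq> 0" "y \<noteq> 0" "x \<noteq> y" using E(2) by auto
      have "v \<notin> {0, x, y, x + y}" using in_E v E(2) by auto
      moreover have "{0, x, y, x + y} - {0} \<subseteq> E" using in_E by auto
      moreover have "v + w \<in> E" if "w \<in> {0, x, y, x + y}" for w using that in_E v by auto
      moreover have "card {0, x, y, x + y} = 2 ^ 2" using pair_generates(2)[OF ne] by simp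
      ultimately have "has_geometry (Suc 2) E"
        using adjoin_coset_geometry[OF pair_generates(1)[OF ne]] by blast
      then show False using free' by blast
    qed
    \<comment> \<open>\<open>E\<close> and its translate by \<open>v\<close> each fill more than
      half of \<open>G\<close>, so they overlap; this makes \<open>F\<close> nonempty.\<close>
    have cardF: "2 * card E \<le> card G + card F"
    proof -
      have "E \<union> (+) v ` E \<subseteq> G" using E vG fin_subgroupD(3)[OF G] by auto
      then have "card (E \<union> (+) v ` E) \<le> card G" using finG by (rule card_mono[rotated])
      moreover have "E \<inter> (+) v ` E = F"
      proof (intro equalityI subsetI)
        fix y assume "y \<in> F"
        then have "y \<in> E" "v + y \<in> E" by (auto simp: F_def)
        then show "y \<in> E \<inter> (+) v ` E" by (auto intro!: image_eqI[of _ _ "v + y"])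
      qed (auto simp: F_def)
      ultimately show ?thesis using card_Un_Int[OF finE, of "(+) v ` E"] finE by simp
    qed
    have "\<exists>n. relation_length F n \<and> odd n"
    proof (rule ccontr)
      assume "\<not> ?thesis"
      then have ev: "even n" if "relation_length F n" for n using that by blast
      have "F \<noteq> {}" using cardF dense by auto
      then obtain H where H: "index2 H G" "H \<inter> F = {}"
        using disjoint_subgroup_if_no_odd_relation[OF G F(1) _ ev] by blast
      note p = index2_props[OF G H(1)]
      \<comment> \<open>\<open>F\<close> is invariant under \<open>v\<close> and lies in the coset
        \<open>G - H\<close>.\<close>
      have vH: "v \<in> H"
      proof (rule ccontr)
        assume "v \<notin> H"
        obtain y where y: "y \<in> F" using \<open>F \<noteq> {}\<close> by blast
        then have "y \<in> G - H" using F H by blast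
        then have "v + y \<in> H" using p(8)[of v y] \<open>v \<notin> H\<close> vG by blast
        moreover have "v + y \<in> F" using y shift by blast
        ultimately show False using H(2) by blast
      qed
      \<comment> \<open>As \<open>F\<close> misses \<open>H\<close>, each pair
        \<open>{y, v + y}\<close> in \<open>H\<close> has a point outside \<open>E\<close>. So
        \<open>E\<close> misses half of \<open>H\<close> and a quarter of the other coset, at least
        3/8 of \<open>G\<close> in total.\<close>
      have "card H \<le> card ((H - E) \<inter> H) * card {0, v}"
      proof (rule card_le_card_times_meeting)
        show "y + s \<in> H" if "y \<in> H" "s \<in> {0, v}" for y s
          using that vH fin_subgroupD(3)[OF p(1)] by auto
        show "\<exists>s\<in>{0, v}. y + s \<in> H - E" if "y \<in> H" for y
        proof -
          have "y \<notin> F" using that H(2) by blast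
          then have "y \<notin> E \<or> v + y \<notin> E" by (simp add: F_def)
          moreover have "v + y \<in> H" using fin_subgroupD(3)[OF p(1) vH that] .
          ultimately show ?thesis using that by (auto simp: add.commute)
        qed
      qed (use p(7) in auto)
      also have "\<dots> \<le> card (H - E) * 2" by (intro mult_le_mono) (auto simp: card_insert_if intro: card_mono p(7))
      finally have "card H \<le> card (H - E) * 2" .
      moreover have "card (G - E) = card (H - E) + card (G - H - E)"
      proof -
        have "card (G - E) = card ((G - E) \<inter> H) + card (G - E - H)"
          by (rule index2_card_Un[OF G H(1)]) blast
        moreover have "(G - E) \<inter> H = H - E" "G - E - H = G - H - E" using p(2) by blast+
        ultimately show ?thesis by simp
      qed
      ultimately show False using bounds(2)[OF H(1)] p(3) dense cardGE by linarith
    qed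
    then show ?thesis
      using triangle_free_not_affine_density[OF G F(1,2) tri] unfolding F_def by blast
  qed
  define N a where "N = real (card G)" and "a = real (card E)"
  have dense': "5 * N < 8 * a" using dense unfolding N_def a_def by linarith
  have Npos: "N > 0" using fin_subgroup_card_pos[OF G] by (simp add: N_def)
  \<comment> \<open>A quarter of \<open>G - H\<close> lies outside \<open>E\<close>, leaving at most
    3/4 of half of \<open>G\<close>.\<close>
  have "real (card (E - H)) \<le> 3 / 8 * N" if H: "index2 H G" for H
  proof -
    note p = index2_props[OF G H]
    have "card (E - H) + card (G - H - E) = card (G - H)"
    proof -
      have "(E - H) \<union> (G - H - E) = G - H" "(E - H) \<inter> (G - H - E) = {}" using E(1) by blast+
      then show ?thesis using card_Un_disjoint[of "E - H" "G - H - E"] finE finG by simp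
    qed
    then have "8 * card (E - H) \<le> 3 * card G" using bounds(2)[OF H] p(3,4) by linarith
    then show ?thesis unfolding N_def by linarith
  qed
  from fourier_cube_lower_bound[OF G E(1) this]
  have "a ^ 3 - (2 * (3 / 8 * N) - a) * (N * a - a\<^sup>2) \<le> N * (\<Sum>x\<in>E. real (card {y\<in>E. x + y \<in> E}))"
    by (simp only: N_def a_def)
  also have "(\<Sum>x\<in>E. real (card {y\<in>E. x + y \<in> E})) \<le> (\<Sum>x\<in>E. 5 / 16 * N)"
  proof (rule sum_mono)
    fix x assume "x \<in> E"
    from local[OF this] show "real (card {y\<in>E. x + y \<in> E}) \<le> 5 / 16 * N" unfolding N_def by linarith
  qed
  also have "(\<Sum>x\<in>E. 5 / 16 * N) = 5 / 16 * a * N" by (simp add: a_def)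
  finally have "a ^ 3 - (2 * (3 / 8 * N) - a) * (N * a - a\<^sup>2) \<le> N * (5 / 16 * a * N)"
    using Npos by simp
  moreover have "a * N * (7 / 4 * a - 17 / 16 * N)
      = a ^ 3 - (2 * (3 / 8 * N) - a) * (N * a - a\<^sup>2) - N * (5 / 16 * a * N)"
    by (simp add: power2_eq_square power3_eq_cube field_simps)
  \<comment> \<open>At density 5/8 the bracket is 35/32 against 34/32, so the Fourier bound exceeds
    the triangle count.\<close>
  moreover have "a * N * (7 / 4 * a - 17 / 16 * N) > 0"
    using dense' Npos by (intro mult_pos_pos) linarith+
  ultimately show False by linarith
qed

text \<open>The quotient by a point \<open>v\<close> of \<open>E\<close> is represented by a complement \<open>G'\<close> of \<open>{0, v}\<close>.\<close>
lemma hyperplane_plane_free: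
  assumes G: "fin_subgroup G" and E: "E \<subseteq> G" "0 \<notin> E" and free: "\<not> has_geometry 4 E"
    and dense: "13 * card G < 16 * card E"
  shows "\<exists>H. index2 H G \<and> \<not> has_geometry 3 (E \<inter> H)"
proof (rule ccontr)
  assume "\<not> ?thesis"
  then have geo: "has_geometry 3 (E \<inter> H)" if "index2 H G" for H using that by blast
  have free': "\<not> has_geometry (Suc 3) E" using free by (simp add: eval_nat_numeral)
  have finG: "finite G" and finE: "finite E" using fin_subgroupD(1)[OF G] E(1) finite_subset by auto
  have bound: "card H \<le> card (G - H - E) * 8" if H: "index2 H G" for H
    using hyperplane_complement_bounds(2)[OF G H geo[OF H] E(2) free'] by simp
  have cardGE: "card (G - E) + card E = card G"
    using finG E(1) by (simp add: card_Diff_subset finE card_mono)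
  have "E \<noteq> {}" using dense by auto
  then obtain v where v: "v \<in> E" by blast
  then have vG: "v \<in> G" "v \<noteq> 0" using E by auto
  obtain G' where G': "index2 G' G" "v \<notin> G'" using index2_exists[OF G vG] by blast
  note p = index2_props[OF G G'(1)]
  define E' where "E' = {x\<in>G'. x \<in> E \<and> v + x \<in> E}"
  have E': "E' \<subseteq> G'" "0 \<notin> E'" using E by (auto simp: E'_def)
  have finE': "finite E'" using E'(1) p(7) finite_subset by blast
  \<comment> \<open>A rank three geometry in \<open>E'\<close>, extended by its coset at
    \<open>v\<close>, would have rank four in \<open>E\<close>.\<close>
  have free3: "\<not> has_geometry 3 E'"
  proof
    assume "has_geometry 3 E'"
    then obtain W where W: "fin_subgroup W" "card W = 2 ^ 3" "W - {0} \<subseteq> E'"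
      unfolding has_geometry_def by blast
    have "W - {0} \<subseteq> E" using W(3) by (auto simp: E'_def)
    moreover have "v \<notin> W" using W(3) E'(1) G'(2) vG by blast
    moreover have "v + w \<in> E" if "w \<in> W" for w
      using that W(3) v by (cases "w = 0") (auto simp: E'_def)
    ultimately show False using adjoin_coset_geometry[OF W(1,2)] free' by blast
  qed
  \<comment> \<open>For each point \<open>x\<close> of \<open>K\<close> outside \<open>E'\<close>,
    one of \<open>x\<close> and \<open>v + x\<close> is outside \<open>E\<close>, and different
    \<open>x\<close> give different points.\<close>
  have cover: "card K - card (E' \<inter> K) \<le> card ((G - E) \<inter> (K \<union> (+) v ` K))" if K: "K \<subseteq> G'" for K
  proof -
    have finK: "finite K" using K p(7) finite_subset by blast
    have "K - E' \<subseteq> (\<lambda>x. if x \<in> G' then x else v + x) ` ((G - E) \<inter> (K \<union> (+) v ` K))"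
    proof
      fix x assume x: "x \<in> K - E'"
      then have xG: "x \<in> G'" using K by blast
      have vx: "v + x \<in> G" "v + x \<notin> G'"
        using xG G'(2) vG p(2) fin_subgroupD(3)[OF G] fin_subgroup_add_iff(2)[OF p(1) xG] by auto
      show "x \<in> (\<lambda>x. if x \<in> G' then x else v + x) ` ((G - E) \<inter> (K \<union> (+) v ` K))"
      proof (cases "x \<in> E")
        case True
        then have "v + x \<notin> E" using x xG by (simp add: E'_def)
        then show ?thesis using vx x by (intro image_eqI[of _ _ "v + x"]) simp_all
      next
        case False
        then show ?thesis using xG x p(2) by (intro image_eqI[of _ _ x]) auto
      qed
    qed
    then have "card (K - E') \<le> card ((G - E) \<inter> (K \<union> (+) v ` K))"
      by (rule surj_card_le[rotated]) (simp add: finG)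
    moreover have "card (K - E') = card K - card (E' \<inter> K)"
      by (metis Int_commute card_Diff_subset_Int finite_Int finK)
    ultimately show ?thesis by simp
  qed
  have "card G' - card E' \<le> card (G - E)"
  proof -
    have "card G' - card (E' \<inter> G') \<le> card ((G - E) \<inter> (G' \<union> (+) v ` G'))" by (rule cover) simp
    also have "\<dots> \<le> card (G - E)" using finG by (intro card_mono) auto
    finally show ?thesis using E'(1) by (simp add: Int_absorb2)
  qed
  \<comment> \<open>Less than 3/16 of \<open>G\<close> is missing from \<open>E\<close>, and this is
    3/8 of \<open>G'\<close>.\<close>
  then have dense': "5 * card G' < 8 * card E'" using dense cardGE p(3) by linarith
  obtain K where K: "index2 K G'" "\<not> has_geometry 2 (E' \<inter> K)"
    using hyperplane_triangle_free[OF p(1) E' free3 dense'] by blast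
  note q = index2_props[OF p(1) K(1)]
  \<comment> \<open>A triangle-free set is disjoint from its translate by one of its own
    elements.\<close>
  have half: "2 * card (E' \<inter> K) \<le> card K"
  proof (cases "E' \<inter> K = {}")
    case False
    then obtain e where e: "e \<in> E'" "e \<in> K" by blast
    have "(E' \<inter> K) \<inter> (+) e ` (E' \<inter> K) = {}"
    proof (rule ccontr)
      assume "\<not> ?thesis"
      then obtain x y where "x \<in> E' \<inter> K" "y \<in> E' \<inter> K" "x = e + y" by blast
      then have "has_geometry 2 (E' \<inter> K)"
        using triangle_has_geometry[of "E' \<inter> K" e y] E'(2) e by auto
      then show False using K by blast
    qed
    then have "card ((E' \<inter> K) \<union> (+) e ` (E' \<inter> K)) = 2 * card (E' \<inter> K)"
      using q(7) by (subst card_Un_disjoint) auto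
    moreover have "(E' \<inter> K) \<union> (+) e ` (E' \<inter> K) \<subseteq> K" using e fin_subgroupD(3)[OF q(1)] by auto
    ultimately show ?thesis using card_mono[OF q(7)] by metis
  qed simp
  \<comment> \<open>\<open>H\<close> is the preimage of \<open>K\<close> under the quotient by
    \<open>v\<close>. At least half of \<open>K\<close>, that is 1/8 of \<open>G\<close>, is missing
    from \<open>E\<close> inside \<open>H\<close>, and \<open>bound\<close> adds 1/8 of the other
    coset, that is 1/16 of \<open>G\<close>. Together these make the excluded 3/16.\<close>
  define H where "H = K \<union> (+) v ` K"
  have vK: "v \<notin> K" using G'(2) q(2) by blast
  have "H \<subseteq> G" using q(2) p(2) vG fin_subgroupD(3)[OF G] by (auto simp: H_def)
  then have H: "index2 H G"
    using fin_subgroup_adjoin(1,2)[OF q(1) vK] p(3) q(3) by (simp add: index2_def H_def)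
  have "card K - card (E' \<inter> K) \<le> card ((G - E) \<inter> H)" unfolding H_def by (rule cover) (rule q(2))
  moreover have "card (G - E) = card ((G - E) \<inter> H) + card (G - E - H)"
    by (rule index2_card_Un[OF G H]) blast
  moreover have "G - E - H = G - H - E" by blast
  ultimately show False
    using bound[OF H] half index2_props(3)[OF G H] q(3) p(3) dense cardGE by simp
qed

text \<open>Restriction to a hyperplane turns density above \<open>d\<close> into density above
  \<open>2 * d - 1\<close>: 13/16 becomes 5/8, then 1/4, the thresholds of the three steps. Two
  hyperplanes and then a subgroup of index at most four give codimension at most four.\<close>

theorem codim4_subgroup:
  assumes G: "fin_subgroup G" and E: "E \<subseteq> G" "0 \<notin> E" and free: "\<not> has_geometry 4 E"
    and dense: "13 * card G < 16 * card E"
  obtains U where "fin_subgroup U" "U \<subseteq> G" "card G \<le> 16 * card U" "U \<inter> E = {}"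
proof -
  obtain H where H: "index2 H G" "\<not> has_geometry 3 (E \<inter> H)"
    using hyperplane_plane_free[OF G E free dense] by blast
  note p = index2_props[OF G H(1)]
  have "card (E - H) \<le> card (G - H)" using p(6) E(1) by (intro card_mono) auto
  then have dense3: "5 * card H < 8 * card (E \<inter> H)"
    using index2_card_Un[OF G H(1) E(1)] p(3,4) dense by linarith
  have E0: "E \<inter> H \<subseteq> H" "0 \<notin> E \<inter> H" using E(2) by auto
  obtain K where K: "index2 K H" "\<not> has_geometry 2 (E \<inter> H \<inter> K)"
    using hyperplane_triangle_free[OF p(1) E0 H(2) dense3] by blast
  note q = index2_props[OF p(1) K(1)]
  have "card (E \<inter> H - K) \<le> card (H - K)" using q(6) by (intro card_mono) auto
  then have dense2: "card K < 4 * card (E \<inter> H \<inter> K)"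
    using index2_card_Un[OF p(1) K(1) E0(1)] q(3,4) dense3 by linarith
  have E1: "E \<inter> H \<inter> K \<subseteq> K" "0 \<notin> E \<inter> H \<inter> K" using E(2) by auto
  have tri: "x + y \<notin> E \<inter> H \<inter> K" if "x \<in> E \<inter> H \<inter> K" "y \<in> E \<inter> H \<inter> K" for x y
    using triangle_has_geometry[OF E1(2) that] K(2) by blast
  obtain U where U: "fin_subgroup U" "U \<subseteq> K" "card K \<le> 4 * card U" "U \<inter> (E \<inter> H \<inter> K) = {}"
    using triangle_free_codim2[OF q(1) E1 tri dense2] by blast
  show thesis
  proof (rule that[OF U(1)])
    show "U \<subseteq> G" using U(2) p(2) q(2) by blast
    show "card G \<le> 16 * card U" using U(3) p(3) q(3) by linarith
    show "U \<inter> E = {}" using U(2,4) q(2) by blast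
  qed
qed

section \<open>Binary matroids\<close>

text \<open>Induction on the rank: a basis of a hyperplane and one point off it. Subset sums are the
  combinations over F_2, and they are distinct because there are as many subsets as elements of
  \<open>W\<close>.\<close>

lemma fin_subgroup_basis:
  assumes "fin_subgroup W" "card W = 2 ^ s"
  shows "\<exists>b. sum b ` Pow {..<s} = W \<and> inj_on (sum b) (Pow {..<s})"
proof -
  have "\<exists>b. sum b ` Pow {..<s} = W" using assms
  proof (induction s arbitrary: W)
    case 0
    then have "W = {0}" using fin_subgroupD(2)[OF 0(1)] by (auto simp: card_1_singleton_iff)
    then show ?case by simp
  next
    case (Suc s)
    have "\<not> W \<subseteq> {0}"
    proof
      assume "W \<subseteq> {0}"
      then have "card W \<le> card {0::'a}" by (intro card_mono) simp_all
      then have "2 * 2 ^ s \<le> (1::nat)" using Suc.prems(2) by simp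
      moreover have "(2::nat) ^ s > 0" by simp
      ultimately show False by linarith
    qed
    then obtain x where x: "x \<in> W" "x \<noteq> 0" by blast
    obtain K where K: "index2 K W" "x \<notin> K" using index2_exists[OF Suc.prems(1) x] by blast
    note p = index2_props[OF Suc.prems(1) K(1)]
    have "card K = 2 ^ s" using p(3) Suc.prems(2) by simp
    then obtain b where b: "sum b ` Pow {..<s} = K" using Suc.IH[OF p(1)] by blast
    define b' where "b' = b(s := x)"
    have old: "sum b' X = sum b X" if "X \<in> Pow {..<s}" for X
      using that unfolding b'_def by (intro sum.cong) auto
    have new: "sum b' (insert s X) = x + sum b X" if "X \<in> Pow {..<s}" for X
    proof -
      have "finite X" "s \<notin> X" using that finite_subset[of X "{..<s}"] by auto
      then show ?thesis using old[OF that] by (simp add: b'_def)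
    qed
    have "sum b' ` Pow {..<Suc s} = sum b' ` Pow {..<s} \<union> (\<lambda>X. sum b' (insert s X)) ` Pow {..<s}"
      by (simp add: lessThan_Suc Pow_insert image_Un image_image)
    also have "sum b' ` Pow {..<s} = K" using old b by (metis image_cong)
    also have "(\<lambda>X. sum b' (insert s X)) ` Pow {..<s} = (\<lambda>X. x + sum b X) ` Pow {..<s}"
      using new by (rule image_cong[OF refl])
    also have "\<dots> = (+) x ` K" using b by (simp add: image_image[symmetric])
    also have "K \<union> (+) x ` K = W" using index2_Diff[OF Suc.prems(1) K(1)] x K(2) p(2) by blast
    finally show ?case by blast
  qed
  then obtain b where b: "sum b ` Pow {..<s} = W" by blast
  have "inj_on (sum b) (Pow {..<s})"
    by (rule eq_card_imp_inj_on) (simp_all add: b assms(2) card_Pow)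
  then show ?thesis using b by blast
qed

section \<open>Binary vectors inside one elementary abelian 2-group\<close>

instance bit :: elem_2_group
  by standard simp

instance "fun" :: (type, elem_2_group) elem_2_group
  by standard (simp add: fun_eq_iff)

text \<open>Vectors of different dimensions do not form one group; padding with zeros embeds every
  \<open>carrier_vec r\<close> into the group \<open>nat \<Rightarrow> bit\<close>.\<close>

definition vec_fun :: "bit vec \<Rightarrow> nat \<Rightarrow> bit" where
  "vec_fun v i = (if i < dim_vec v then v $ i else 0)"

text \<open>Turns coordinate vectors into the index sets of the subset sums in
  \<open>fin_subgroup_basis\<close>.\<close>

definition vec_support :: "bit vec \<Rightarrow> nat set" where
  "vec_support v = {i. i < dim_vec v \<and> v $ i = 1}"

lemma bit_cases: "(x::bit) = 0 \<or> x = 1"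
  by (cases x) simp_all

lemma vec_fun_add: "u \<in> carrier_vec r \<Longrightarrow> v \<in> carrier_vec r \<Longrightarrow> vec_fun (u + v) = vec_fun u + vec_fun v"
  by (auto simp: vec_fun_def fun_eq_iff)

lemma vec_fun_zero: "vec_fun (0\<^sub>v r) = 0"
  by (auto simp: vec_fun_def fun_eq_iff)

lemma vec_of_vec_fun: "v \<in> carrier_vec r \<Longrightarrow> vec r (vec_fun v) = v"
  by (auto simp: vec_fun_def)

lemma inj_vec_fun: "inj_on vec_fun (carrier_vec r)"
  by (metis inj_onI vec_of_vec_fun)

lemma bij_vec_support: "bij_betw vec_support (carrier_vec r) (Pow {..<r})"
proof (rule bij_betw_byWitness[where f' = "\<lambda>X. vec r (\<lambda>i. if i \<in> X then 1 else 0)"])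
  show "\<forall>v\<in>carrier_vec r. vec r (\<lambda>i. if i \<in> vec_support v then 1 else 0) = v"
    using bit_cases by (auto simp: vec_support_def)
qed (auto simp: vec_support_def split: if_splits)

lemma vec_support_zero: "vec_support (0\<^sub>v r) = {}"
  by (auto simp: vec_support_def)

lemma finite_carrier_vec_bit: "finite (carrier_vec r :: bit vec set)"
  using bij_betw_finite[OF bij_vec_support] by simp

lemma card_carrier_vec_bit: "card (carrier_vec r :: bit vec set) = 2 ^ r"
  using bij_betw_same_card[OF bij_vec_support] by (simp add: card_Pow)

lemma vec_support_add:
  assumes "u \<in> carrier_vec r" "v \<in> carrier_vec r"
  shows "vec_support (u + v) = sym_diff (vec_support u) (vec_support v)"
proof -
  have "(x + y = 1) \<longleftrightarrow> (x = 1) \<noteq> (y = 1)" for x y :: bit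
    using bit_cases[of x] bit_cases[of y] by auto
  then show ?thesis using assms by (auto simp: vec_support_def)
qed

lemma fin_subgroup_vec_fun_image: "fin_subgroup (vec_fun ` carrier_vec r)"
  unfolding fin_subgroup_def
proof (intro conjI ballI)
  show "0 \<in> vec_fun ` carrier_vec r"
    by (rule image_eqI[of _ _ "0\<^sub>v r"]) (simp_all add: vec_fun_zero)
  fix x y assume "x \<in> vec_fun ` carrier_vec r" "y \<in> vec_fun ` carrier_vec r"
  then obtain u v where uv: "u \<in> carrier_vec r" "v \<in> carrier_vec r" "x = vec_fun u" "y = vec_fun v" by blast
  then show "x + y \<in> vec_fun ` carrier_vec r"
    by (intro image_eqI[of _ _ "u + v"]) (simp_all add: vec_fun_add)
qed (simp add: finite_carrier_vec_bit)

text \<open>The embedding sends a vector to the sum of the basis elements indexed by its support. It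
  is additive because supports add by symmetric difference, and over F_2 additive maps are
  linear.\<close>

lemma contains_proj_geom:
  assumes E: "edges M \<subseteq> carrier_vec (mrank M)" and geo: "has_geometry s (vec_fun ` edges M)"
  shows "contains_matroid M (proj_geom s)"
proof -
  define r where "r = mrank M"
  obtain W where W: "fin_subgroup W" "card W = 2 ^ s" "W - {0} \<subseteq> vec_fun ` edges M"
    using geo unfolding has_geometry_def by blast
  obtain b where b: "sum b ` Pow {..<s} = W" "inj_on (sum b) (Pow {..<s})"
    using fin_subgroup_basis[OF W(1,2)] by blast
  define \<iota> where "\<iota> = (\<lambda>v. vec r (sum b (vec_support v)))"
  have supp: "vec_support v \<in> Pow {..<s}" if "v \<in> carrier_vec s" for v
    using that by (auto simp: vec_support_def)
  have Wr: "W \<subseteq> vec_fun ` carrier_vec r"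
    using W(3) E fin_subgroupD(2)[OF fin_subgroup_vec_fun_image[of r]] unfolding r_def by blast
  have injW: "inj_on (vec r) W"
  proof (rule inj_onI)
    fix x y assume "x \<in> W" "y \<in> W" and eq: "vec r x = vec r y"
    then obtain u v where uv: "u \<in> carrier_vec r" "v \<in> carrier_vec r" "x = vec_fun u" "y = vec_fun v" using Wr by blast
    then show "x = y" using eq by (simp add: vec_of_vec_fun)
  qed
  have inj: "inj_on \<iota> (carrier_vec s)"
  proof (rule inj_onI)
    fix u v assume uv: "u \<in> carrier_vec s" "v \<in> carrier_vec s" "\<iota> u = \<iota> v"
    then have "sum b (vec_support u) = sum b (vec_support v)"
      using inj_onD[OF injW] b(1) supp unfolding \<iota>_def by blast
    then have "vec_support u = vec_support v" using inj_onD[OF b(2)] supp uv by blast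
    then show "u = v" using bij_betw_imp_inj_on[OF bij_vec_support, of s] uv by (meson inj_onD)
  qed
  have carrier: "\<iota> v \<in> carrier_vec r" for v by (simp add: \<iota>_def)
  have zero: "\<iota> (0\<^sub>v s) = 0\<^sub>v r"
    by (auto simp: \<iota>_def vec_support_zero)
  have add: "\<iota> (u + v) = \<iota> u + \<iota> v" if uv: "u \<in> carrier_vec s" "v \<in> carrier_vec s" for u v
  proof -
    have "finite (vec_support u)" "finite (vec_support v)" by (simp_all add: vec_support_def)
    then have "sum b (vec_support (u + v)) = sum b (vec_support u) + sum b (vec_support v)"
      by (simp only: vec_support_add[OF uv] sum_sym_diff)
    then show ?thesis by (auto simp: \<iota>_def)
  qed
  have smult: "\<iota> (c \<cdot>\<^sub>v v) = c \<cdot>\<^sub>v \<iota> v" if "v \<in> carrier_vec s" for c v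
  proof (cases "c = 0")
    case True
    then have "c \<cdot>\<^sub>v v = 0\<^sub>v s" "c \<cdot>\<^sub>v \<iota> v = 0\<^sub>v r" using that carrier[of v] by auto
    then show ?thesis using zero by simp
  next
    case False
    then have "c = 1" using bit_cases[of c] by simp
    then show ?thesis by simp
  qed
  have "\<iota> \<in> LinearCombinations.module_hom F2 (F2_space s) (F2_space r)"
    unfolding LinearCombinations.module_hom_def
    by (simp add: module_vec_simps carrier add smult)
  then have "linear_map F2 (F2_space s) (F2_space r) \<iota>"
    by (intro linear_map.intro mod_hom.intro mod_hom_axioms.intro vec_vs vec_module)
  moreover have "\<iota> ` (carrier_vec s - {0\<^sub>v s}) \<subseteq> edges M"
  proof (rule image_subsetI)
    fix v :: "bit vec" assume v: "v \<in> carrier_vec s - {0\<^sub>v s}"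
    define x where "x = sum b (vec_support v)"
    have xW: "x \<in> W" unfolding x_def using supp[of v] v b(1) by blast
    have "\<iota> v \<noteq> 0\<^sub>v r"
      using inj_onD[OF inj, of v "0\<^sub>v s"] v zero by auto
    moreover have "vec r (0 :: nat \<Rightarrow> bit) = 0\<^sub>v r" by auto
    ultimately have "x \<noteq> 0" by (auto simp: \<iota>_def x_def)
    then obtain e where e: "e \<in> edges M" "x = vec_fun e" using xW W(3) by blast
    then have "\<iota> v = e" using vec_of_vec_fun[of e r] E by (auto simp: \<iota>_def x_def[symmetric] r_def)
    then show "\<iota> v \<in> edges M" using e by simp
  qed
  ultimately show ?thesis
    using inj unfolding contains_matroid_def proj_geom_def r_def by auto
qed

section \<open>Subgroups as subspaces, and their codimension\<close>

lemma subspace_of_subgroup: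
  assumes U: "fin_subgroup U" "U \<subseteq> vec_fun ` carrier_vec r"
  defines "W \<equiv> {v \<in> carrier_vec r. vec_fun v \<in> U}"
  shows "VectorSpace.subspace F2 W (F2_space r)" "card W = card U" "finite W"
proof -
  have "c \<cdot>\<^sub>v v \<in> W" if "v \<in> W" for c v
  proof (cases "c = 0")
    case True
    then have "c \<cdot>\<^sub>v v = 0\<^sub>v r" using that by (auto simp: W_def)
    then show ?thesis using fin_subgroupD(2)[OF U(1)] by (simp add: W_def vec_fun_zero)
  next
    case False
    then have "c = 1" using bit_cases[of c] by simp
    then show ?thesis using that by simp
  qed
  moreover have "u + v \<in> W" if "u \<in> W" "v \<in> W" for u v
    using that fin_subgroupD(3)[OF U(1)] by (auto simp: W_def vec_fun_add)
  moreover have "0\<^sub>v r \<in> W" using fin_subgroupD(2)[OF U(1)] by (simp add: W_def vec_fun_zero)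
  moreover have "W \<subseteq> carrier_vec r" by (auto simp: W_def)
  ultimately have "submodule F2 W (F2_space r)"
    by (intro submodule.intro vec_module) (simp_all add: module_vec_simps)
  then show "VectorSpace.subspace F2 W (F2_space r)"
    unfolding VectorSpace.subspace_def using vec_vs by blast
  have "vec_fun ` W = U" using U(2) by (auto simp: W_def)
  moreover have "inj_on vec_fun W" using inj_vec_fun by (rule inj_on_subset) (auto simp: W_def)
  ultimately show "card W = card U" by (metis card_image)
  show "finite W" using finite_carrier_vec_bit[of r] by (simp add: W_def)
qed

text \<open>Every element of \<open>W\<close> is a combination of a basis with coefficients 0 and 1,
  so \<open>card W\<close> is at most 2 to the dimension, and a large \<open>W\<close> has small
  codimension.\<close>

lemma subspace_codim_le:
  assumes W: "VectorSpace.subspace F2 W (F2_space r)" "finite W" and card: "2 ^ r \<le> 2 ^ m * card W"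
  shows "\<exists>k\<le>m. F2_subspace_codim r W k"
proof -
  interpret V: vec_space "TYPE(bit)" r .
  let ?VW = "(F2_space r)\<lparr>carrier := W\<rparr>"
  have sub: "submodule F2 W (F2_space r)" using W(1) by (simp add: VectorSpace.subspace_def)
  have vsW: "vectorspace F2 ?VW" by (rule V.subspace_is_vs[OF W(1)])
  interpret VW: vectorspace F2 ?VW by (rule vsW)
  have "W \<subseteq> VW.span W"
    by (rule VW.in_own_span) simp
  moreover have "VW.span W \<subseteq> carrier ?VW" by (rule VW.span_is_subset2) simp
  ultimately have "VW.gen_set W" by simp
  then have fd: "VW.fin_dim" unfolding VW.fin_dim_def using W(2) by (intro exI[of _ W]) simp
  obtain \<beta> where \<beta>: "finite \<beta>" "VW.basis \<beta>" using VW.finite_basis_exists[OF fd] by blast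
  have dim: "VW.dim = card \<beta>" by (rule VW.dim_basis[OF \<beta>])
  have \<beta>W: "\<beta> \<subseteq> carrier ?VW" "VW.span \<beta> = carrier ?VW" using \<beta>(2) unfolding VW.basis_def by blast+
  have "W \<subseteq> (\<lambda>A. VW.lincomb (\<lambda>v. if v \<in> A then 1 else 0) \<beta>) ` Pow \<beta>"
  proof
    fix w assume "w \<in> W"
    then have "w \<in> VW.span \<beta>" using \<beta>W(2) by simp
    then obtain a where a: "w = VW.lincomb a \<beta>" unfolding VW.finite_span[OF \<beta>(1) \<beta>W(1)] by blast
    have "VW.lincomb a \<beta> = VW.lincomb (\<lambda>v. if v \<in> {v\<in>\<beta>. a v = 1} then 1 else 0) \<beta>"
      using bit_cases by (intro VW.lincomb_cong refl \<beta>W(1)) auto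
    then show "w \<in> (\<lambda>A. VW.lincomb (\<lambda>v. if v \<in> A then 1 else 0) \<beta>) ` Pow \<beta>"
      using a by blast
  qed
  then have "card W \<le> card (Pow \<beta>)" using \<beta>(1) by (intro surj_card_le) simp_all
  then have "card W \<le> 2 ^ VW.dim" using \<beta>(1) dim by (simp add: card_Pow)
  then have "2 ^ r \<le> (2::nat) ^ m * 2 ^ VW.dim" using card by (meson le_trans mult_le_mono2)
  then have "(2::nat) ^ r \<le> 2 ^ (m + VW.dim)" by (simp add: power_add)
  then have "r \<le> m + VW.dim" by (simp add: power_le_imp_le_exp)
  moreover have "VW.dim \<le> r"
    using V.subspace_dim[OF W(1) V.fin_dim fd] by (simp only: V.dim_is_n)
  ultimately have "r - VW.dim \<le> m \<and> F2_subspace_codim r W (r - VW.dim)"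
    unfolding F2_subspace_codim_def using W(1) by simp
  then show ?thesis by blast
qed

theorem theorem4p6:
  shows "\<not> (\<exists>M :: binary_matroid.
    simple_binary_matroid M \<and>
    matroid_free (proj_geom 4) M \<and>
    real (card (edges M)) > (1 - 3 * (2 :: real) powi (- 4)) * 2 ^ mrank M \<and>
    critical_number M > 4)"
proof
  assume "\<exists>M :: binary_matroid.
    simple_binary_matroid M \<and>
    matroid_free (proj_geom 4) M \<and>
    real (card (edges M)) > (1 - 3 * (2 :: real) powi (- 4)) * 2 ^ mrank M \<and>
    critical_number M > 4"
  then obtain M where simple: "simple_binary_matroid M" and free: "matroid_free (proj_geom 4) M"
    and dense: "real (card (edges M)) > (1 - 3 * (2 :: real) powi (- 4)) * 2 ^ mrank M"
    and crit: "critical_number M > 4" by blast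
  define r where "r = mrank M"
  define G where "G = vec_fun ` carrier_vec r"
  define E where "E = vec_fun ` edges M"
  have edges: "edges M \<subseteq> carrier_vec r" "0\<^sub>v r \<notin> edges M"
    using simple unfolding simple_binary_matroid_def r_def by auto
  have G: "fin_subgroup G" unfolding G_def by (rule fin_subgroup_vec_fun_image)
  have cardG: "card G = 2 ^ r"
    unfolding G_def by (simp add: card_image[OF inj_vec_fun] card_carrier_vec_bit)
  have cardE: "card E = card (edges M)"
    unfolding E_def using inj_on_subset[OF inj_vec_fun edges(1)] by (rule card_image)
  have EG: "E \<subseteq> G" using edges(1) unfolding E_def G_def by blast
  have "0 \<notin> E"
  proof
    assume "0 \<in> E"
    then obtain e where e: "e \<in> edges M" "vec_fun e = vec_fun (0\<^sub>v r)" unfolding E_def by (auto simp: vec_fun_zero)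
    then have "e = 0\<^sub>v r" using inj_onD[OF inj_vec_fun[of r]] edges(1) by auto
    then show False using e(1) edges(2) by simp
  qed
  moreover have "\<not> has_geometry 4 E"
    using free contains_proj_geom[of M 4] edges(1) unfolding matroid_free_def E_def r_def by blast
  \<comment> \<open>The factor \<open>1 - 3 * 2 powi (- 4)\<close> is 13/16.\<close>
  moreover have "13 * card G < 16 * card E"
  proof -
    have "real (card E) > 13 / 16 * real (card G)"
      using dense by (simp add: cardE cardG r_def power_int_minus)
    then show ?thesis by linarith
  qed
  ultimately obtain U where U: "fin_subgroup U" "U \<subseteq> G" "card G \<le> 16 * card U" "U \<inter> E = {}"
    using codim4_subgroup[OF G EG] by blast
  define W where "W = {v \<in> carrier_vec r. vec_fun v \<in> U}"
  note sub = subspace_of_subgroup[OF U(1) U(2)[unfolded G_def], folded W_def]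
  have "2 ^ r \<le> 2 ^ 4 * card W" using U(3) by (simp add: cardG sub(2))
  then obtain k where k: "k \<le> 4" "F2_subspace_codim r W k"
    using subspace_codim_le[OF sub(1,3)] by blast
  have "W \<inter> edges M = {}" using U(4) unfolding W_def E_def by blast
  then have "critical_number M \<le> k"
    unfolding critical_number_def using k(2) unfolding r_def by (intro Least_le) blast
  then show False using crit k(1) by simp
qed

end
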